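(* For every integer $\ell\ge4$ there exists $\delta=\delta(\ell)>0$ such that whp $S(G_{n/2}^{\mathcal C_\ell})=\omega(1)$ and $L_1(G_{n/2+\delta n}^{\mathcal C_\ell})=o(n)$; that is, $S(G_{n/2}^{\mathcal C_\ell})\overset{\mathrm p}{\to}\infty$ and $L_1(G_{n/2+\delta n}^{\mathcal C_\ell})/n\overset{\mathrm p}{\to}0$ as $n\to\infty$.
   Context: For each $n$, the rule $\mathcal C_\ell$ defines a random sequence $(G_i^{\mathcal C_\ell})_{i\ge0}$ of graphs on $[n]$ as follows. $G_0^{\mathcal C_\ell}$ is the empty graph (no edges). In step $i+1$, $\ell$ vertices $v_1,\ldots,v_\ell$ are chosen from $[n]$ independently and uniformly at random (independently of previous steps); let $c_j$ be the size (number of vertices) of the component of $G_i^{\mathcal C_\ell}$ containing $v_j$. During the first $n/2$ steps the pair $v_1v_2$ is added. In all later steps the rule $\mathcal M_\ell$ is used, which always connects by an edge two of the vertices $v_j$ with the two smallest component sizes $c_j$ (ties broken by some fixed deterministic convention). (A pair with $v_a=v_b$ or an already present edge does not affect the component structure.) $L_1(G)$ is the number of vertices in a largest component of $G$; for an $n$-vertex graph $G$, $S(G)=\sum_{k}kN_k(G)/n$, where $N_k(G)$ is the number of vertices in components of size $k$. $\overset{\mathrm p}{\to}$ denotes convergence in probability; $X_n\overset{\mathrm p}{\to}\infty$ means $\Pr(X_n\le C)\to0$ for every $C>0$. "Whp" means with probability tending to $1$ as $n\to\infty$. Rounding to integers is ignored. *)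

theory Defs
  imports "HOL-Probability.Probability"
begin

text \<open>A graph on \<open>[n] = {1..n}\<close> is given by its set of edges, each edge being a two-element set.\<close>

type_synonym graph = "nat set set"

definition component :: "nat \<Rightarrow> graph \<Rightarrow> nat \<Rightarrow> nat set" where
  "component n G v = {u \<in> {1..n}. (v, u) \<in> {(x, y). {x, y} \<in> G}\<^sup>*}"

definition comp_size :: "nat \<Rightarrow> graph \<Rightarrow> nat \<Rightarrow> nat" where
  "comp_size n G v = card (component n G v)"

definition N :: "nat \<Rightarrow> graph \<Rightarrow> nat \<Rightarrow> nat" where
  "N n G k = card {v \<in> {1..n}. comp_size n G v = k}"

definition S :: "nat \<Rightarrow> graph \<Rightarrow> real" where
  "S n G = (\<Sum>k = 1..n. real k * real (N n G k) / real n)"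

definition L1 :: "nat \<Rightarrow> graph \<Rightarrow> nat" where
  "L1 n G = Max (comp_size n G ` {1..n})"

definition add_pair :: "nat \<Rightarrow> nat \<Rightarrow> graph \<Rightarrow> graph" where
  "add_pair x y G = (if x = y then G else insert {x, y} G)"

text \<open>
  \<open>are_two_smallest l c (a, b)\<close>: the distinct indices \<open>a\<close>, \<open>b\<close> attain the two smallest
  values (with multiplicity) among \<open>c 1, \<dots>, c l\<close>.
\<close>

definition are_two_smallest :: "nat \<Rightarrow> (nat \<Rightarrow> nat) \<Rightarrow> nat \<times> nat \<Rightarrow> bool" where
  "are_two_smallest l c = (\<lambda>(a, b).
     a \<in> {1..l} \<and> b \<in> {1..l} \<and> a \<noteq> b \<and>
     (\<forall>j \<in> {1..l} - {a, b}. c a \<le> c j \<and> c b \<le> c j))"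

text \<open>
  A deterministic convention for the rule \<open>M\<^sub>l\<close> maps \<open>n\<close>, the current graph and the chosen
  vertices \<open>v 1, \<dots>, v l\<close> to the indices of the two vertices to be joined. The only
  freedom left to it is how ties between component sizes are broken.
\<close>

type_synonym convention = "nat \<Rightarrow> graph \<Rightarrow> (nat \<Rightarrow> nat) \<Rightarrow> nat \<times> nat"

definition M_rule :: "nat \<Rightarrow> convention \<Rightarrow> bool" where
  "M_rule l pick \<longleftrightarrow>
     (\<forall>n G v. (\<forall>j \<in> {1..l}. v j \<in> {1..n}) \<longrightarrow>
        are_two_smallest l (\<lambda>j. comp_size n G (v j)) (pick n G v))"

text \<open>
  A sample \<open>\<omega>\<close> assigns to \<open>(i, j)\<close> the \<open>j\<close>-th vertex chosen in step \<open>i + 1\<close>; all of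
  these are independent and uniform on \<open>[n]\<close>.
\<close>

definition vertex_space :: "nat \<Rightarrow> nat \<Rightarrow> (nat \<times> nat \<Rightarrow> nat) measure" where
  "vertex_space l n = (\<Pi>\<^sub>M p \<in> UNIV \<times> {1..l}. uniform_count_measure {1..n})"

primrec C_graph :: "convention \<Rightarrow> nat \<Rightarrow> nat \<Rightarrow> (nat \<times> nat \<Rightarrow> nat) \<Rightarrow> graph" where
  "C_graph pick n 0 \<omega> = {}"
| "C_graph pick n (Suc i) \<omega> =
     (let G = C_graph pick n i \<omega>;
          v = (\<lambda>j. \<omega> (i, j));
          (a, b) = (if Suc i \<le> n div 2 then (1, 2) else pick n G v)
      in add_pair (v a) (v b) G)"

text \<open>
  Convergence in probability for variables \<open>X n\<close> living on different probability spaces \<open>M n\<close>.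
\<close>

definition tendsto_in_prob :: "(nat \<Rightarrow> 'a measure) \<Rightarrow> (nat \<Rightarrow> 'a \<Rightarrow> real) \<Rightarrow> real \<Rightarrow> bool" where
  "tendsto_in_prob M X c \<longleftrightarrow>
     (\<forall>\<epsilon>>0. (\<lambda>n. measure (M n) {\<omega> \<in> space (M n). \<bar>X n \<omega> - c\<bar> > \<epsilon>}) \<longlonglongrightarrow> 0)"

definition tendsto_infinity_in_prob :: "(nat \<Rightarrow> 'a measure) \<Rightarrow> (nat \<Rightarrow> 'a \<Rightarrow> real) \<Rightarrow> bool" where
  "tendsto_infinity_in_prob M X \<longleftrightarrow>
     (\<forall>C>0. (\<lambda>n. measure (M n) {\<omega> \<in> space (M n). X n \<omega> \<le> C}) \<longlonglongrightarrow> 0)"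

end

theory Submission
  imports Defs
begin

text \<open>
  Write \<open>c v\<close> for the number of vertices in the component of \<open>v\<close>.

  The first \<open>n/2\<close> steps produce a critical random graph. Everything needed about it is read off
  the average \<open>W x\<close> of \<open>1 - exp (- x c v)\<close> over all vertices \<open>v\<close> (the function \<open>gap\<close>). Joining
  components of sizes \<open>a\<close> and \<open>b\<close> raises \<open>n W x\<close> by
  \<open>a e\<^sup>-\<^sup>x\<^sup>a (1 - e\<^sup>-\<^sup>x\<^sup>b) + b e\<^sup>-\<^sup>x\<^sup>b (1 - e\<^sup>-\<^sup>x\<^sup>a)\<close>, so one uniformly random pair raises \<open>W x\<close> by
  \<open>(2/n) W x W' x\<close> on average, up to \<open>O(1/n\<^sup>2)\<close>: this is a discrete version of the inviscid Burgers
  equation, whose solutions are constant along straight lines. At time 0 one has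
  \<open>W y = w\<close> with \<open>w = 1 - e\<^sup>-\<^sup>y\<close>, and so \<open>W\<close> stays close to \<open>w\<close> along \<open>x\<^sub>i = y - 2 i w / n\<close>.
  The single steps are \<open>O(1/n)\<close>, and a Gronwall argument bounds the second moment of the error
  by \<open>O(1/n)\<close> (\<open>gap_second_moment\<close>). After \<open>n/2\<close> steps this reads
  \<open>W (y - w) \<approx> w\<close>, where \<open>y - w\<close> is of order \<open>y\<^sup>2\<close> and \<open>w\<close> is of order \<open>y\<close>. There are two
  consequences. Since \<open>W x \<le> x S\<close>, the susceptibility is whp at least of order \<open>1/y\<close>, for every
  fixed small \<open>y\<close> (\<open>critical_S_unbounded\<close>). Since a vertex in a component of size at least \<open>k\<close>
  contributes at least \<open>1 - e\<^sup>-\<^sup>x\<^sup>k\<close> to the average, the choice \<open>y \<approx> k\<^sup>-\<^sup>1\<^sup>/\<^sup>2\<close> shows that whp at most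
  \<open>O(k\<^sup>-\<^sup>1\<^sup>/\<^sup>2) n\<close> vertices lie in such components (\<open>critical_large_bound\<close>).

  The rule that joins the two smallest components preserves this power law for \<open>\<delta> n\<close> further steps.
  A step can only add vertices to components of size at least \<open>k\<close> if the larger of the two joined
  components has size at least \<open>k/2\<close>, and then at least \<open>l - 1 \<ge> 3\<close> of the chosen vertices lie in
  components of size at least \<open>k/2\<close>. If these hold a fraction \<open>O(k\<^sup>-\<^sup>1\<^sup>/\<^sup>2)\<close> of the vertices, the
  step has probability \<open>O(k\<^sup>-\<^sup>3\<^sup>/\<^sup>2)\<close>; it moves at most \<open>2 k\<close> vertices, and so \<open>\<delta> n\<close>
  steps move \<open>O(\<delta> k\<^sup>-\<^sup>1\<^sup>/\<^sup>2 n)\<close> vertices. For small \<open>\<delta>\<close> this is less than the bound that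
  holds at criticality, for all \<open>k\<close> at once. The induction over the scales \<open>k = 4 ^ j\<close> is
  \<open>supercritical_large_bound\<close>; concentration comes from an exponential moment
  (\<open>large_tail_bound\<close>). A component of size \<open>\<epsilon> n\<close> would violate the bound for a large fixed
  \<open>k\<close>.
\<close>

section \<open>Uniform samples of the vertex choices\<close>

text \<open>
  The graph after \<open>T\<close> steps depends on finitely many uniform choices only, so probabilities and
  expectations are averages over a finite set of samples; \<open>choices\<close> is the set of outcomes of a
  single step.
\<close>

definition samples :: "nat \<Rightarrow> nat \<Rightarrow> nat \<Rightarrow> (nat \<times> nat \<Rightarrow> nat) set" where
  "samples l n T = ({..<T} \<times> {1..l}) \<rightarrow>\<^sub>E {1..n}"

definition choices :: "nat \<Rightarrow> nat \<Rightarrow> (nat \<Rightarrow> nat) set" where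
  "choices l n = {1..l} \<rightarrow>\<^sub>E {1..n}"

definition mean :: "'a set \<Rightarrow> ('a \<Rightarrow> real) \<Rightarrow> real" where
  "mean A F = (\<Sum>x\<in>A. F x) / real (card A)"

lemma mean_mono: "(\<And>x. x \<in> A \<Longrightarrow> F x \<le> H x) \<Longrightarrow> mean A F \<le> mean A H"
  unfolding mean_def by (intro divide_right_mono sum_mono) auto

lemma mean_cong: "(\<And>x. x \<in> A \<Longrightarrow> F x = H x) \<Longrightarrow> mean A F = mean A H"
  unfolding mean_def by (simp cong: sum.cong)

lemma mean_add: "mean A (\<lambda>x. F x + H x) = mean A F + mean A H"
  unfolding mean_def by (simp add: sum.distrib add_divide_distrib)

lemma mean_cmult: "mean A (\<lambda>x. c * F x) = c * mean A F"
  unfolding mean_def by (simp add: sum_distrib_left)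

lemma mean_const: "finite A \<Longrightarrow> A \<noteq> {} \<Longrightarrow> mean A (\<lambda>x. c) = c"
  unfolding mean_def by simp

lemma mean_nonneg: "(\<And>x. x \<in> A \<Longrightarrow> 0 \<le> F x) \<Longrightarrow> 0 \<le> mean A F"
  unfolding mean_def by (intro divide_nonneg_nonneg sum_nonneg) auto

lemma finite_choices [simp]: "finite (choices l n)"
  unfolding choices_def by (intro finite_PiE) auto

lemma finite_samples [simp]: "finite (samples l n T)"
  unfolding samples_def by (intro finite_PiE) auto

lemma card_choices: "card (choices l n) = n ^ l"
  unfolding choices_def by (simp add: card_PiE)

lemma choices_nonempty: "n \<ge> 1 \<Longrightarrow> choices l n \<noteq> {}"
  unfolding choices_def by (simp add: PiE_eq_empty_iff)

lemma samples_nonempty: "n \<ge> 1 \<Longrightarrow> samples l n T \<noteq> {}"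
  unfolding samples_def by (simp add: PiE_eq_empty_iff)

definition next_graph :: "convention \<Rightarrow> nat \<Rightarrow> nat \<Rightarrow> graph \<Rightarrow> (nat \<Rightarrow> nat) \<Rightarrow> graph" where
  "next_graph pick n i G v =
     (let (a, b) = (if Suc i \<le> n div 2 then (1, 2) else pick n G v) in add_pair (v a) (v b) G)"

lemma C_graph_Suc:
  "C_graph pick n (Suc i) \<omega> = next_graph pick n i (C_graph pick n i \<omega>) (\<lambda>j. \<omega> (i, j))"
  by (simp add: next_graph_def Let_def)

text \<open>
  Replacing the outcome of one step turns conditioning on the past into a plain average: the
  graphs up to time \<open>i\<close> do not notice a change of row \<open>i\<close>.
\<close>

definition set_row :: "nat \<Rightarrow> (nat \<Rightarrow> nat) \<Rightarrow> (nat \<times> nat \<Rightarrow> nat) \<Rightarrow> (nat \<times> nat \<Rightarrow> nat)" where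
  "set_row i v \<omega> = (\<lambda>p. if fst p = i then v (snd p) else \<omega> p)"

lemma C_graph_set_row: "j \<le> i \<Longrightarrow> C_graph pick n j (set_row i v \<omega>) = C_graph pick n j \<omega>"
proof (induction j)
  case (Suc j)
  then have "(\<lambda>k. set_row i v \<omega> (j, k)) = (\<lambda>k. \<omega> (j, k))"
    by (auto simp: set_row_def)
  with Suc show ?case
    by (simp only: C_graph_Suc)
qed simp

lemma C_graph_Suc_set_row:
  "C_graph pick n (Suc i) (set_row i v \<omega>) = next_graph pick n i (C_graph pick n i \<omega>) v"
proof -
  have "(\<lambda>k. set_row i v \<omega> (i, k)) = v"
    by (auto simp: set_row_def)
  then show ?thesis
    by (simp only: C_graph_Suc C_graph_set_row[OF order_refl])
qed

text \<open>
  Resampling one row preserves the uniform distribution. Exchanging the new row with the old one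
  is an involution of the pairs of a sample and a row.
\<close>

lemma mean_resample_row:
  assumes "i < T" "n \<ge> 1"
  shows "mean (samples l n T) F
           = mean (samples l n T) (\<lambda>\<omega>. mean (choices l n) (\<lambda>v. F (set_row i v \<omega>)))"
proof -
  let ?S = "samples l n T" and ?R = "choices l n"
  let ?swap = "\<lambda>(\<omega>, v). (set_row i v \<omega>, \<lambda>j. \<omega> (i, j))"
  have mem: "?swap p \<in> ?S \<times> ?R" if "p \<in> ?S \<times> ?R" for p
    using that \<open>i < T\<close>
    by (fastforce simp: samples_def choices_def set_row_def PiE_iff extensional_def split: if_splits)
  have inv: "?swap (?swap p) = p" if "p \<in> ?S \<times> ?R" for p
    by (auto simp: set_row_def split: prod.splits)
  have "(\<Sum>\<omega>\<in>?S. \<Sum>v\<in>?R. F (set_row i v \<omega>)) = (\<Sum>p\<in>?S \<times> ?R. F (fst (?swap p)))"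
    by (simp add: sum.cartesian_product split_beta)
  also have "\<dots> = (\<Sum>p\<in>?S \<times> ?R. F (fst p))"
    by (rule sum.reindex_bij_witness[of _ ?swap ?swap]) (use mem inv in auto)
  also have "\<dots> = (\<Sum>\<omega>\<in>?S. \<Sum>v\<in>?R. F \<omega>)"
    by (simp add: sum.cartesian_product split_beta cong: sum.cong del: sum_constant)
  finally have *: "(\<Sum>\<omega>\<in>?S. \<Sum>v\<in>?R. F (set_row i v \<omega>)) = real (card ?R) * (\<Sum>\<omega>\<in>?S. F \<omega>)"
    by (simp add: sum_distrib_left)
  have "real (card ?R) > 0"
    using choices_nonempty[OF assms(2), of l] by (simp add: card_gt_0_iff)
  then show ?thesis
    unfolding mean_def using * choices_nonempty[OF assms(2), of l]
    by (simp flip: sum_divide_distrib)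
qed

text \<open>
  The form of the Markov property that all drift estimates use; the graph at the earlier time \<open>h\<close>
  is carried along so that an estimate can be restricted to a good starting graph.
\<close>

lemma mean_one_step:
  assumes "i < T" "n \<ge> 1" "h \<le> i"
  shows "mean (samples l n T) (\<lambda>\<omega>. H (C_graph pick n h \<omega>) (C_graph pick n (Suc i) \<omega>))
           = mean (samples l n T) (\<lambda>\<omega>. mean (choices l n) (\<lambda>v.
               H (C_graph pick n h \<omega>) (next_graph pick n i (C_graph pick n i \<omega>) v)))"
  by (subst mean_resample_row[OF assms(1,2)])
     (simp only: C_graph_set_row[OF assms(3)] C_graph_Suc_set_row)

text \<open>
  An event that depends on the first \<open>T\<close> steps only is a cylinder set over a finite product of
  uniform measures, in which all points have the same mass.
\<close>

lemma measure_vertex_space: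
  assumes n: "n \<ge> 1"
  assumes dep: "\<And>\<omega>. \<omega> \<in> space (vertex_space l n) \<Longrightarrow> Q \<omega> \<longleftrightarrow> Q (restrict \<omega> ({..<T} \<times> {1..l}))"
  shows "measure (vertex_space l n) {\<omega> \<in> space (vertex_space l n). Q \<omega>}
           = mean (samples l n T) (\<lambda>\<omega>. of_bool (Q \<omega>))"
proof -
  let ?I = "(UNIV :: nat set) \<times> {1..l}" and ?J = "{..<T} \<times> {1..l}"
  let ?u = "uniform_count_measure {1..n}"
  let ?M = "\<lambda>_ :: nat \<times> nat. ?u"
  interpret u: prob_space ?u
    by (rule prob_space_uniform_count_measure) (use n in auto)
  interpret product_prob_space ?M ?I
    by unfold_locales
  interpret J: finite_product_prob_space ?M ?J
    by unfold_locales auto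
  let ?X = "{\<omega> \<in> samples l n T. Q \<omega>}"
  have sp: "space (PiM ?J ?M) = samples l n T"
    by (simp add: space_PiM samples_def space_uniform_count_measure)
  have single: "{\<omega>} = Pi\<^sub>E ?J (\<lambda>p. {\<omega> p})" if "\<omega> \<in> samples l n T" for \<omega>
    using that by (intro PiE_singleton[symmetric]) (auto simp: samples_def PiE_iff)
  have sets1: "{\<omega>} \<in> sets (PiM ?J ?M)" if "\<omega> \<in> samples l n T" for \<omega>
    unfolding single[OF that] using that
    by (intro sets_PiM_I_finite) (auto simp: sets_uniform_count_measure samples_def)
  have meas1: "measure (PiM ?J ?M) {\<omega>} = 1 / real (card (samples l n T))"
    if "\<omega> \<in> samples l n T" for \<omega>
  proof -
    have "measure (PiM ?J ?M) {\<omega>} = (\<Prod>p\<in>?J. measure ?u {\<omega> p})"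
      unfolding single[OF that] using that
      by (intro J.finite_measure_PiM_emb) (auto simp: sets_uniform_count_measure samples_def)
    also have "\<dots> = (\<Prod>p\<in>?J. 1 / real n)"
      using that
      by (intro prod.cong refl, subst measure_uniform_count_measure) (auto simp: samples_def PiE_iff)
    also have "\<dots> = 1 / real (card (samples l n T))"
      by (simp add: samples_def card_PiE power_divide)
    finally show ?thesis .
  qed
  have X: "?X \<in> sets (PiM ?J ?M)"
  proof -
    have "?X = (\<Union>\<omega>\<in>?X. {\<omega>})" by auto
    also have "\<dots> \<in> sets (PiM ?J ?M)"
      by (intro sets.finite_UN sets1) simp_all
    finally show ?thesis .
  qed
  have "restrict \<omega> ?J \<in> samples l n T" if "\<omega> \<in> space (vertex_space l n)" for \<omega>
    using that
    by (simp add: vertex_space_def space_PiM samples_def space_uniform_count_measure PiE_iff)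
  moreover have "prod_emb ?I ?M ?J ?X = {\<omega> \<in> space (vertex_space l n). restrict \<omega> ?J \<in> ?X}"
    by (auto simp only: prod_emb_def vertex_space_def space_PiM)
  ultimately have "{\<omega> \<in> space (vertex_space l n). Q \<omega>} = prod_emb ?I ?M ?J ?X"
    using dep by blast
  then have "measure (vertex_space l n) {\<omega> \<in> space (vertex_space l n). Q \<omega>} = measure (PiM ?J ?M) ?X"
    using emeasure_PiM_emb'[OF _ _ X]
    by (simp add: vertex_space_def measure_def Sigma_mono)
  also have "\<dots> = (\<Sum>\<omega>\<in>?X. measure (PiM ?J ?M) {\<omega>})"
    by (intro J.finite_measure_eq_sum_singleton sets1) simp_all
  also have "\<dots> = (\<Sum>\<omega>\<in>?X. 1 / real (card (samples l n T)))"
    by (intro sum.cong refl meas1) auto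
  also have "\<dots> = mean (samples l n T) (\<lambda>\<omega>. of_bool (Q \<omega>))"
    by (simp add: mean_def sum.If_cases Int_def)
  finally show ?thesis .
qed

lemma sum_PiE_insert:
  assumes "x \<notin> A"
  shows "(\<Sum>v\<in>Pi\<^sub>E (insert x A) B. F v) = (\<Sum>y\<in>B x. \<Sum>v\<in>Pi\<^sub>E A B. F (v(x := y)))"
  unfolding PiE_insert_eq
  by (subst sum.reindex[OF inj_combinator[OF assms]])
     (simp add: sum.cartesian_product split_beta)

lemma mean_choices_first_two:
  assumes "l \<ge> 2" "n \<ge> 1"
  shows "mean (choices l n) (\<lambda>v. f (v 1) (v 2)) = (\<Sum>a = 1..n. \<Sum>b = 1..n. f a b) / (real n)\<^sup>2"
proof -
  have I: "{1..l} = insert 1 (insert 2 {3..l})"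
    using assms(1) by auto
  have "(\<Sum>v\<in>choices l n. f (v 1) (v 2))
          = (\<Sum>a = 1..n. \<Sum>b = 1..n. \<Sum>v\<in>{3..l} \<rightarrow>\<^sub>E {1..n}. f a b)"
    unfolding choices_def I by (subst sum_PiE_insert, simp, subst sum_PiE_insert, simp_all)
  also have "\<dots> = real (n ^ (l - 2)) * (\<Sum>a = 1..n. \<Sum>b = 1..n. f a b)"
    by (simp add: card_PiE sum_distrib_left)
  finally have "(\<Sum>v\<in>choices l n. f (v 1) (v 2)) = real (n ^ (l - 2)) * (\<Sum>a = 1..n. \<Sum>b = 1..n. f a b)" .
  moreover have "real n ^ l = real n ^ (l - 2) * (real n)\<^sup>2"
    using assms(1) by (metis le_add_diff_inverse2 power_add)
  ultimately show ?thesis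
    using assms by (simp add: mean_def card_choices)
qed

lemma mean_of_bool_tendsto_0_mono:
  assumes "(\<lambda>n. mean (A n) (\<lambda>\<omega>. of_bool (Q n \<omega>))) \<longlonglongrightarrow> 0"
    and "\<forall>\<^sub>F n in sequentially. \<forall>\<omega>. P n \<omega> \<longrightarrow> Q n \<omega>"
  shows "(\<lambda>n. mean (A n) (\<lambda>\<omega>. of_bool (P n \<omega>))) \<longlonglongrightarrow> 0"
proof (rule tendsto_sandwich[where f = "\<lambda>_. 0" and h = "\<lambda>n. mean (A n) (\<lambda>\<omega>. of_bool (Q n \<omega>))"])
  show "\<forall>\<^sub>F n in sequentially. 0 \<le> mean (A n) (\<lambda>\<omega>. of_bool (P n \<omega>))"
    by (intro always_eventually allI mean_nonneg) simp
  show "\<forall>\<^sub>F n in sequentially. mean (A n) (\<lambda>\<omega>. of_bool (P n \<omega>)) \<le> mean (A n) (\<lambda>\<omega>. of_bool (Q n \<omega>))"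
    using assms(2) by eventually_elim (auto intro!: mean_mono)
qed (use assms(1) in simp_all)

lemma C_graph_restrict:
  assumes "\<omega> \<in> space (vertex_space l n)" "i \<le> T"
  shows "C_graph pick n i (restrict \<omega> ({..<T} \<times> {1..l})) = C_graph pick n i \<omega>"
  using assms(2)
proof (induction i)
  case (Suc i)
  have "restrict \<omega> ({..<T} \<times> {1..l}) (i, k) = \<omega> (i, k)" for k
    using assms(1) Suc.prems
    by (auto simp: vertex_space_def space_PiM PiE_iff extensional_def restrict_def)
  then show ?case
    using Suc by (simp only: C_graph_Suc Suc_leD)
qed simp

lemma tendsto_measure_vertex_space:
  assumes "(\<lambda>n. mean (samples l n (T n)) (\<lambda>\<omega>. of_bool (Q n (C_graph pick n (i n) \<omega>)))) \<longlonglongrightarrow> 0"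
    and "\<And>n. i n \<le> T n"
  shows "(\<lambda>n. measure (vertex_space l n)
           {\<omega> \<in> space (vertex_space l n). Q n (C_graph pick n (i n) \<omega>)}) \<longlonglongrightarrow> 0"
proof (rule Lim_transform_eventually[OF assms(1)])
  show "\<forall>\<^sub>F n in sequentially. mean (samples l n (T n)) (\<lambda>\<omega>. of_bool (Q n (C_graph pick n (i n) \<omega>)))
          = measure (vertex_space l n) {\<omega> \<in> space (vertex_space l n). Q n (C_graph pick n (i n) \<omega>)}"
    using eventually_ge_at_top[of 1]
  proof eventually_elim
    case (elim n)
    show ?case
      by (rule measure_vertex_space[symmetric]) (use elim C_graph_restrict assms(2) in auto)
  qed
qed

section \<open>Components after joining two vertices\<close>

lemma mem_component_iff:
  "u \<in> component n G v \<longleftrightarrow> u \<in> {1..n} \<and> (v, u) \<in> {(x, y). {x, y} \<in> G}\<^sup>*"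
  by (simp add: component_def)

lemma connected_sym: "(v, u) \<in> {(x, y). {x, y} \<in> G}\<^sup>* \<Longrightarrow> (u, v) \<in> {(x, y). {x, y} \<in> G}\<^sup>*"
proof -
  have "sym ({(x, y). {x, y} \<in> G}\<^sup>*)"
    by (intro sym_rtrancl) (auto simp: sym_def insert_commute)
  then show "(v, u) \<in> {(x, y). {x, y} \<in> G}\<^sup>* \<Longrightarrow> (u, v) \<in> {(x, y). {x, y} \<in> G}\<^sup>*"
    by (auto dest: symD)
qed

lemma finite_component [simp]: "finite (component n G v)"
  by (simp add: component_def)

lemma component_subset: "component n G v \<subseteq> {1..n}"
  by (auto simp: component_def)

lemma self_in_component: "v \<in> {1..n} \<Longrightarrow> v \<in> component n G v"
  by (simp add: mem_component_iff)

lemma component_eq: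
  assumes "u \<in> component n G v"
  shows "component n G u = component n G v"
  using assms connected_sym[of v u G] by (auto simp: mem_component_iff dest: rtrancl_trans)

lemma component_disjoint_or_eq:
  "component n G u = component n G v \<or> component n G u \<inter> component n G v = {}"
  using component_eq by blast

lemma comp_size_pos: "v \<in> {1..n} \<Longrightarrow> comp_size n G v \<ge> 1"
  using self_in_component[of v n G]
  by (auto simp: comp_size_def Suc_le_eq card_gt_0_iff)

lemma comp_size_le: "comp_size n G v \<le> n"
  using card_mono[OF _ component_subset[of n G v]] by (simp add: comp_size_def)

text \<open>
  Declaring the vertices connected to \<open>a\<close> or \<open>b\<close> to form one class and leaving the other classes
  as they are gives an equivalence relation that contains the new edge.
\<close>

lemma component_add_pair:
  assumes "a \<in> {1..n}" "b \<in> {1..n}" "v \<in> {1..n}"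
  shows "component n (add_pair a b G) v =
           (if v \<in> component n G a \<union> component n G b then component n G a \<union> component n G b
            else component n G v)"
proof (cases "a = b")
  case True
  then show ?thesis
    by (auto simp: add_pair_def dest: component_eq)
next
  case False
  let ?R = "{(x, y). {x, y} \<in> G}" and ?R' = "{(x, y). {x, y} \<in> insert {a, b} G}"
  define U where "U = {x. (a, x) \<in> ?R\<^sup>* \<or> (b, x) \<in> ?R\<^sup>*}"
  have mono: "?R\<^sup>* \<subseteq> ?R'\<^sup>*"
    by (intro rtrancl_mono) auto
  have ab: "(a, b) \<in> ?R'\<^sup>*" "(b, a) \<in> ?R'\<^sup>*"
    by (auto intro!: r_into_rtrancl simp: insert_commute)
  have into: "(x, y) \<in> ?R'\<^sup>*" if "x \<in> U" "y \<in> U" for x y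
  proof -
    have "(x, a) \<in> ?R'\<^sup>*" "(a, y) \<in> ?R'\<^sup>*"
      using that mono ab connected_sym[of _ x G] unfolding U_def
      by (blast intro: rtrancl_trans)+
    then show ?thesis by (rule rtrancl_trans)
  qed
  have out: "(x, y) \<in> ?R\<^sup>* \<or> x \<in> U \<and> y \<in> U" if "(x, y) \<in> ?R'\<^sup>*" for x y
    using that
  proof (induction rule: rtrancl_induct)
    case (step y z)
    from step.hyps(2) consider "(y, z) \<in> ?R" | "y = a \<and> z = b" | "y = b \<and> z = a"
      by (auto simp: doubleton_eq_iff)
    then show ?case
    proof cases
      case 1
      with step.IH show ?thesis
        unfolding U_def by (auto intro: rtrancl_into_rtrancl)
    qed (use step.IH connected_sym[of x y G] in \<open>auto simp: U_def\<close>)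
  qed simp
  have U: "x \<in> U \<longleftrightarrow> x \<in> component n G a \<union> component n G b" if "x \<in> {1..n}" for x
    using that by (auto simp: U_def mem_component_iff)
  have closed: "y \<in> U" if "x \<in> U" "(x, y) \<in> ?R\<^sup>*" for x y
    using that unfolding U_def by (auto intro: rtrancl_trans)
  have G': "add_pair a b G = insert {a, b} G"
    using False by (simp add: add_pair_def)
  have sub: "component n G a \<union> component n G b \<subseteq> {1..n}"
    using component_subset by auto
  show ?thesis
  proof (cases "v \<in> U")
    case True
    have "component n (insert {a, b} G) v = {x \<in> {1..n}. x \<in> U}"
      unfolding set_eq_iff mem_component_iff using True into out closed by blast
    also have "\<dots> = component n G a \<union> component n G b"
      using U sub by blast
    finally show ?thesis
      using True U[OF assms(3)] G' by simp
  next
    case False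
    have "component n (insert {a, b} G) v = component n G v"
      unfolding set_eq_iff mem_component_iff using False out mono by blast
    then show ?thesis
      using False U[OF assms(3)] G' by simp
  qed
qed

lemma comp_size_add_pair:
  assumes "a \<in> {1..n}" "b \<in> {1..n}" "v \<in> {1..n}"
  shows "comp_size n (add_pair a b G) v =
           (if v \<in> component n G a \<union> component n G b
            then if component n G a = component n G b then comp_size n G a
                 else comp_size n G a + comp_size n G b
            else comp_size n G v)"
  using component_disjoint_or_eq[of n G a b]
  by (auto simp: comp_size_def component_add_pair[OF assms] card_Un_disjoint)

text \<open>
  All functionals of the process are sums over the vertices of a function of the component size,
  and this is how such a sum reacts to one step.
\<close>

lemma sum_comp_size_add_pair:
  fixes g :: "nat \<Rightarrow> real" and G :: graph
  assumes "a \<in> {1..n}" "b \<in> {1..n}"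
  defines "\<alpha> \<equiv> comp_size n G a" and "\<beta> \<equiv> comp_size n G b"
  shows "(\<Sum>v = 1..n. g (comp_size n (add_pair a b G) v)) =
           (\<Sum>v = 1..n. g (comp_size n G v)) +
           (if component n G a = component n G b then 0
            else real (\<alpha> + \<beta>) * g (\<alpha> + \<beta>) - real \<alpha> * g \<alpha> - real \<beta> * g \<beta>)"
proof (cases "component n G a = component n G b")
  case True
  have "comp_size n (add_pair a b G) v = comp_size n G v" if "v \<in> {1..n}" for v
  proof -
    have "component n (add_pair a b G) v = component n G v"
      using True component_eq[of v n G a] by (simp add: component_add_pair[OF assms(1,2) that])
    then show ?thesis by (simp add: comp_size_def)
  qed
  then show ?thesis using True by simp
next
  case False
  let ?A = "component n G a" and ?B = "component n G b"
  let ?d = "\<lambda>v. g (comp_size n (add_pair a b G) v) - g (comp_size n G v)"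
  have disj: "?A \<inter> ?B = {}"
    using False component_disjoint_or_eq by blast
  have old: "comp_size n G v = (if v \<in> ?A then \<alpha> else \<beta>)" if "v \<in> ?A \<union> ?B" for v
    using that component_eq[of v n G a] component_eq[of v n G b]
    by (auto simp: \<alpha>_def \<beta>_def comp_size_def)
  have new: "comp_size n (add_pair a b G) v = \<alpha> + \<beta>" if "v \<in> ?A \<union> ?B" for v
    using that False component_subset[of n G a] component_subset[of n G b]
    by (subst comp_size_add_pair[OF assms(1,2)]) (auto simp: \<alpha>_def \<beta>_def)
  have "(\<Sum>v = 1..n. ?d v) = (\<Sum>v \<in> ?A \<union> ?B. ?d v)"
    using component_subset[of n G]
    by (intro sum.mono_neutral_right) (auto simp: comp_size_add_pair[OF assms(1,2)])
  also have "\<dots> = (\<Sum>v \<in> ?A. ?d v) + (\<Sum>v \<in> ?B. ?d v)"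
    using disj by (intro sum.union_disjoint) auto
  also have "(\<Sum>v \<in> ?A. ?d v) = (\<Sum>v \<in> ?A. g (\<alpha> + \<beta>) - g \<alpha>)"
    by (intro sum.cong refl) (simp add: new old)
  also have "(\<Sum>v \<in> ?B. ?d v) = (\<Sum>v \<in> ?B. g (\<alpha> + \<beta>) - g \<beta>)"
    using disj by (intro sum.cong refl) (auto simp: new old)
  finally show ?thesis
    using False by (simp add: sum_subtractf \<alpha>_def \<beta>_def comp_size_def algebra_simps)
qed

section \<open>A transform of the component size distribution\<close>

text \<open>
  The gap between 1 and the Laplace transform of the component size of a uniformly chosen vertex,
  together with its derivative.
\<close>

definition gap :: "nat \<Rightarrow> graph \<Rightarrow> real \<Rightarrow> real" where
  "gap n G x = (\<Sum>v = 1..n. 1 - exp (- (x * real (comp_size n G v)))) / real n"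

definition slope :: "nat \<Rightarrow> graph \<Rightarrow> real \<Rightarrow> real" where
  "slope n G x = (\<Sum>v = 1..n. real (comp_size n G v) * exp (- (x * real (comp_size n G v)))) / real n"

lemma mult_exp_neg_le:
  fixes x c :: real
  assumes "x > 0" "c \<ge> 0"
  shows "c * exp (- (x * c)) \<le> 1 / x"
proof -
  have "x * c \<le> exp (x * c)"
    using exp_ge_add_one_self[of "x * c"] by linarith
  then show ?thesis
    using assms by (simp add: exp_minus field_simps)
qed

lemma square_mult_exp_neg_le:
  fixes x c :: real
  assumes "x > 0" "c \<ge> 0"
  shows "c\<^sup>2 * exp (- (x * c)) \<le> 4 / x\<^sup>2"
proof -
  have "c\<^sup>2 * exp (- (x * c)) = (c * exp (- (x / 2 * c)))\<^sup>2"
    by (simp add: power_mult_distrib flip: exp_double)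
  also have "\<dots> \<le> (1 / (x / 2))\<^sup>2"
    using mult_exp_neg_le[of "x / 2" c] assms by (intro power_mono) auto
  finally show ?thesis
    by (simp add: power_divide)
qed

lemma one_minus_exp_neg_bounds:
  fixes t :: real
  assumes "t \<ge> 0"
  shows "t - t\<^sup>2 \<le> 1 - exp (- t)" "1 - exp (- t) \<le> t"
proof -
  have "(1 - t + t\<^sup>2) * (1 + t) = 1 + t ^ 3"
    by (simp add: algebra_simps power2_eq_square power3_eq_cube)
  then have "1 \<le> (1 - t + t\<^sup>2) * (1 + t)"
    using assms by simp
  also have "\<dots> \<le> (1 - t + t\<^sup>2) * exp t"
  proof (rule mult_left_mono)
    have "1 - t + t\<^sup>2 = (1 - t)\<^sup>2 + t" by (simp add: power2_diff)
    then show "0 \<le> 1 - t + t\<^sup>2" using assms by (simp only:) simp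
  qed simp
  finally show "t - t\<^sup>2 \<le> 1 - exp (- t)"
    by (simp add: exp_minus field_simps)
  show "1 - exp (- t) \<le> t"
    using exp_ge_add_one_self[of "- t"] by linarith
qed

lemma gap_bounds: "x \<ge> 0 \<Longrightarrow> 0 \<le> gap n G x" "gap n G x \<le> 1"
proof -
  show "x \<ge> 0 \<Longrightarrow> 0 \<le> gap n G x"
    unfolding gap_def by (intro divide_nonneg_nonneg sum_nonneg) auto
  have "(\<Sum>v = 1..n. 1 - exp (- (x * real (comp_size n G v)))) \<le> (\<Sum>v = 1..n. 1)"
    by (intro sum_mono) auto
  then show "gap n G x \<le> 1"
    unfolding gap_def by (cases "n = 0") (auto simp: field_simps)
qed

lemma slope_bounds:
  assumes "x > 0"
  shows "0 \<le> slope n G x" "slope n G x \<le> 1 / x"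
proof -
  show "0 \<le> slope n G x"
    unfolding slope_def by (intro divide_nonneg_nonneg sum_nonneg) auto
  have "(\<Sum>v = 1..n. real (comp_size n G v) * exp (- (x * real (comp_size n G v)))) \<le> (\<Sum>v = 1..n. 1 / x)"
    using assms by (intro sum_mono mult_exp_neg_le) auto
  then show "slope n G x \<le> 1 / x"
    unfolding slope_def using assms by (cases "n = 0") (auto simp: field_simps)
qed

text \<open>
  The first-order Taylor expansion in \<open>x\<close>; the error is uniform in the graph because
  \<open>c\<^sup>2 e\<^sup>-\<^sup>x\<^sup>c\<close> is bounded in \<open>c\<close>.
\<close>

lemma gap_shift:
  assumes "x > 0" "h \<ge> 0"
  shows "\<bar>gap n G (x + h) - (gap n G x + h * slope n G x)\<bar> \<le> 4 * h\<^sup>2 / x\<^sup>2"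
proof (cases "n = 0")
  case False
  define c where "c v = real (comp_size n G v)" for v
  define r where "r v = (1 - exp (- ((x + h) * c v))) - ((1 - exp (- (x * c v))) + h * (c v * exp (- (x * c v))))" for v
  have r: "\<bar>r v\<bar> \<le> 4 * h\<^sup>2 / x\<^sup>2" for v
  proof -
    have c: "c v \<ge> 0" by (simp add: c_def)
    have *: "r v = exp (- (x * c v)) * ((1 - exp (- (h * c v))) - h * c v)"
      by (simp add: r_def algebra_simps flip: exp_add)
    have "\<bar>(1 - exp (- (h * c v))) - h * c v\<bar> \<le> (h * c v)\<^sup>2"
      using one_minus_exp_neg_bounds[of "h * c v"] assms c by (simp add: abs_if)
    then have "\<bar>r v\<bar> \<le> exp (- (x * c v)) * (h * c v)\<^sup>2"
      unfolding * by (simp add: abs_mult)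
    also have "\<dots> = h\<^sup>2 * ((c v)\<^sup>2 * exp (- (x * c v)))"
      by (simp add: power_mult_distrib)
    also have "\<dots> \<le> h\<^sup>2 * (4 / x\<^sup>2)"
      using assms c by (intro mult_left_mono square_mult_exp_neg_le) auto
    also have "\<dots> = 4 * h\<^sup>2 / x\<^sup>2" by simp
    finally show ?thesis .
  qed
  have "gap n G (x + h) - (gap n G x + h * slope n G x) = (\<Sum>v = 1..n. r v) / real n"
    by (simp add: gap_def slope_def r_def c_def sum_subtractf sum.distrib sum_distrib_left
        diff_divide_distrib add_divide_distrib)
  also have "\<bar>\<dots>\<bar> \<le> (\<Sum>v = 1..n. \<bar>r v\<bar>) / real n"
    by (simp add: divide_right_mono)
  also have "\<dots> \<le> (\<Sum>v = 1..n. 4 * h\<^sup>2 / x\<^sup>2) / real n"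
    by (rule divide_right_mono[OF sum_mono[OF r]]) simp
  also have "\<dots> = 4 * h\<^sup>2 / x\<^sup>2"
    using False by simp
  finally show ?thesis .
qed (use assms in \<open>simp add: gap_def slope_def\<close>)

definition gap_incr :: "nat \<Rightarrow> graph \<Rightarrow> real \<Rightarrow> nat \<Rightarrow> nat \<Rightarrow> real" where
  "gap_incr n G x a b = gap n (add_pair a b G) x - gap n G x"

lemma gap_incr_eq:
  fixes G :: graph
  assumes "a \<in> {1..n}" "b \<in> {1..n}"
  defines "\<alpha> \<equiv> real (comp_size n G a)" and "\<beta> \<equiv> real (comp_size n G b)"
  shows "gap_incr n G x a b =
           (if component n G a = component n G b then 0
            else \<alpha> * exp (- (x * \<alpha>)) * (1 - exp (- (x * \<beta>)))
               + \<beta> * exp (- (x * \<beta>)) * (1 - exp (- (x * \<alpha>)))) / real n"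
proof -
  have e: "exp (- (x * real (comp_size n G a + comp_size n G b))) = exp (- (x * \<alpha>)) * exp (- (x * \<beta>))"
    by (simp add: \<alpha>_def \<beta>_def algebra_simps flip: exp_add)
  have "gap_incr n G x a b =
          (if component n G a = component n G b then 0
           else real (comp_size n G a + comp_size n G b) * (1 - exp (- (x * real (comp_size n G a + comp_size n G b))))
              - \<alpha> * (1 - exp (- (x * \<alpha>))) - \<beta> * (1 - exp (- (x * \<beta>)))) / real n"
    unfolding gap_incr_def gap_def diff_divide_distrib[symmetric] \<alpha>_def \<beta>_def
      sum_comp_size_add_pair[OF assms(1,2), where g = "\<lambda>c. 1 - exp (- (x * real c))"]
    by (simp only: add_diff_cancel_left')
  also have "\<dots> = (if component n G a = component n G b then 0
            else \<alpha> * exp (- (x * \<alpha>)) * (1 - exp (- (x * \<beta>)))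
               + \<beta> * exp (- (x * \<beta>)) * (1 - exp (- (x * \<alpha>)))) / real n"
    unfolding e by (simp add: \<alpha>_def \<beta>_def algebra_simps)
  finally show ?thesis .
qed

lemma gap_incr_bounds:
  assumes "a \<in> {1..n}" "b \<in> {1..n}" "x > 0"
  shows "0 \<le> gap_incr n G x a b" "gap_incr n G x a b \<le> 2 / (x * real n)"
proof -
  define \<alpha> \<beta> where "\<alpha> = real (comp_size n G a)" and "\<beta> = real (comp_size n G b)"
  have nn: "\<alpha> \<ge> 0" "\<beta> \<ge> 0" by (auto simp: \<alpha>_def \<beta>_def)
  have e: "0 \<le> 1 - exp (- (x * \<alpha>))" "0 \<le> 1 - exp (- (x * \<beta>))"
    using nn assms by auto
  let ?t = "\<alpha> * exp (- (x * \<alpha>)) * (1 - exp (- (x * \<beta>))) + \<beta> * exp (- (x * \<beta>)) * (1 - exp (- (x * \<alpha>)))"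
  have t0: "0 \<le> ?t"
    using nn e by (intro add_nonneg_nonneg mult_nonneg_nonneg) auto
  have "?t \<le> 1 / x * 1 + 1 / x * 1"
    using nn e assms by (intro add_mono mult_mono mult_exp_neg_le) auto
  then have t1: "?t \<le> 2 / x" by simp
  show "0 \<le> gap_incr n G x a b"
    unfolding gap_incr_eq[OF assms(1,2)] \<alpha>_def[symmetric] \<beta>_def[symmetric]
    using t0 by (intro divide_nonneg_nonneg) auto
  have "gap_incr n G x a b \<le> (2 / x) / real n"
    unfolding gap_incr_eq[OF assms(1,2)] \<alpha>_def[symmetric] \<beta>_def[symmetric]
    using t1 assms by (intro divide_right_mono) auto
  then show "gap_incr n G x a b \<le> 2 / (x * real n)" by simp
qed

text \<open>
  The formula for the increment is symmetric bilinear in \<open>c e\<^sup>-\<^sup>x\<^sup>c\<close> and \<open>1 - e\<^sup>-\<^sup>x\<^sup>c\<close>, so that its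
  average over all pairs factorises. Pairs inside one component do not contribute to the increment.
  Together they make up at most \<open>O(1/n\<^sup>2)\<close>, even if there is a giant component, since their summands
  decay exponentially in the component size.
\<close>

lemma average_gap_incr:
  assumes n: "n \<ge> 1" and x: "x > 0"
  shows "\<bar>(\<Sum>a = 1..n. \<Sum>b = 1..n. gap_incr n G x a b) / (real n)\<^sup>2
            - 2 / real n * slope n G x * gap n G x\<bar> \<le> 8 / (x\<^sup>2 * (real n)\<^sup>2)"
proof -
  define c where "c v = real (comp_size n G v)" for v
  define p where "p v = c v * exp (- (x * c v))" for v
  define q where "q v = 1 - exp (- (x * c v))" for v
  define same where "same a b = (if component n G a = component n G b then p a * q b + p b * q a else 0)" for a b
  have q0: "0 \<le> q v" "q v \<le> 1" for v
    using x by (auto simp: q_def c_def)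
  have A: "(\<Sum>a = 1..n. \<Sum>b = 1..n. gap_incr n G x a b)
             = ((\<Sum>a = 1..n. \<Sum>b = 1..n. p a * q b + p b * q a) - (\<Sum>a = 1..n. \<Sum>b = 1..n. same a b)) / real n"
    unfolding sum_subtractf[symmetric] sum_divide_distrib
    by (intro sum.cong refl, subst gap_incr_eq) (auto simp: same_def p_def q_def c_def)
  have "(\<Sum>a = 1..n. \<Sum>b = 1..n. p a * q b + p b * q a)
          = (\<Sum>a = 1..n. p a) * (\<Sum>b = 1..n. q b) + (\<Sum>a = 1..n. q a) * (\<Sum>b = 1..n. p b)"
    unfolding sum_product sum.distrib[symmetric] by (intro sum.cong refl) (simp add: mult.commute)
  also have "\<dots> = 2 * (real n)\<^sup>2 * slope n G x * gap n G x"
    using n unfolding slope_def gap_def p_def q_def c_def by (simp add: power2_eq_square)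
  finally have B: "(\<Sum>a = 1..n. \<Sum>b = 1..n. p a * q b + p b * q a) = 2 * (real n)\<^sup>2 * slope n G x * gap n G x" .
  have row: "0 \<le> (\<Sum>b = 1..n. same a b) \<and> (\<Sum>b = 1..n. same a b) \<le> 8 / x\<^sup>2" for a
  proof -
    have "(\<Sum>b = 1..n. same a b) = (\<Sum>b \<in> component n G a. 2 * (p a * q a))"
    proof (intro sum.mono_neutral_cong_right ballI)
      show "same a b = 0" if "b \<in> {1..n} - component n G a" for b
        using that self_in_component[of b n G] by (auto simp: same_def)
      show "same a b = 2 * (p a * q a)" if "b \<in> component n G a" for b
        using component_eq[OF that] by (simp add: same_def p_def q_def c_def comp_size_def)
    qed (use component_subset in auto)
    also have "\<dots> = 2 * ((c a)\<^sup>2 * exp (- (x * c a))) * q a"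
      by (simp add: p_def c_def comp_size_def power2_eq_square)
    finally have s: "(\<Sum>b = 1..n. same a b) = 2 * ((c a)\<^sup>2 * exp (- (x * c a))) * q a" .
    have "2 * ((c a)\<^sup>2 * exp (- (x * c a))) * q a \<le> 2 * (4 / x\<^sup>2) * 1"
      using square_mult_exp_neg_le[OF x, of "c a"] q0[of a] by (intro mult_mono) (auto simp: c_def)
    then show ?thesis unfolding s using q0[of a] by simp
  qed
  define E where "E = (\<Sum>a = 1..n. \<Sum>b = 1..n. same a b)"
  have E0: "0 \<le> E"
    unfolding E_def by (intro sum_nonneg conjunct1[OF row])
  have "E \<le> (\<Sum>a = 1..n. 8 / x\<^sup>2)"
    unfolding E_def by (intro sum_mono conjunct2[OF row])
  then have E1: "E \<le> real n * (8 / x\<^sup>2)" by simp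
  have "(2 * (real n)\<^sup>2 * S * W - E) / real n / (real n)\<^sup>2 - 2 / real n * S * W = - (E / real n ^ 3)" for S W
    using n by (simp add: field_simps power2_eq_square power3_eq_cube)
  then have "(\<Sum>a = 1..n. \<Sum>b = 1..n. gap_incr n G x a b) / (real n)\<^sup>2
            - 2 / real n * slope n G x * gap n G x = - (E / real n ^ 3)"
    unfolding A B E_def[symmetric] by simp
  also have "\<bar>\<dots>\<bar> = E / real n ^ 3"
    using E0 by simp
  also have "\<dots> \<le> (real n * (8 / x\<^sup>2)) / real n ^ 3"
    using E1 by (rule divide_right_mono) simp
  also have "\<dots> = 8 / (x\<^sup>2 * (real n)\<^sup>2)"
    using n by (simp add: power2_eq_square power3_eq_cube)
  finally show ?thesis .
qed

text \<open>
  Squaring \<open>1 - y/2 \<le> e\<^sup>-\<^sup>y\<^sup>/\<^sup>2\<close>. The quadratic order of \<open>y - (1 - e\<^sup>-\<^sup>y)\<close> is what makes the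
  exponent of the critical power law \<open>1/2\<close>.
\<close>

lemma quadratic_le_exp_neg:
  fixes y :: real
  assumes "0 \<le> y" "y \<le> 2"
  shows "y\<^sup>2 / 4 \<le> y - (1 - exp (- y))"
proof -
  have "(1 - y / 2)\<^sup>2 \<le> (exp (- (y / 2)))\<^sup>2"
    using exp_ge_add_one_self[of "- (y / 2)"] assms by (intro power_mono) auto
  also have "\<dots> = exp (- y)"
    by (simp flip: exp_double)
  finally show ?thesis
    by (simp add: power2_eq_square field_simps)
qed

section \<open>The random graph at criticality\<close>

text \<open>
  The arithmetic of one step along the characteristic line, with \<open>d = 1/n\<close>. Here \<open>e\<close> and \<open>q\<close> are
  the deviations of the gap from \<open>w\<close> before and after the argument is moved, \<open>D\<close> is the slope
  and \<open>Z\<close> the gap at the new argument, and \<open>m1\<close>, \<open>m2\<close> are the first two moments of the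
  increment caused by the new edge. Moving the argument lowers the gap by \<open>2 d w D\<close>, and the edge raises it
  by \<open>2 d Z D\<close> on average. As \<open>Z - w = q\<close>, the two effects cancel up to \<open>2 d D q\<close>, a
  relative error of order \<open>d\<close>.
\<close>

lemma second_moment_step:
  fixes d K e q r D Z w m1 m2 :: real
  assumes d: "0 < d" "d \<le> 1" and D: "0 \<le> D" "D \<le> K" and w: "0 \<le> w" "w \<le> 1"
    and Z: "0 \<le> Z" "Z \<le> 1" "Z = w + q"
    and e: "e = q + 2 * d * w * D - r" and r: "\<bar>r\<bar> \<le> 16 * K\<^sup>2 * d\<^sup>2"
    and m1: "\<bar>m1 - 2 * d * D * Z\<bar> \<le> 8 * K\<^sup>2 * d\<^sup>2" and m2: "m2 \<le> 4 * K\<^sup>2 * d\<^sup>2"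
  shows "q\<^sup>2 + 2 * q * m1 + m2 \<le> (1 + 4 * K * d) * e\<^sup>2 + (68 * K\<^sup>2 + 128 * K ^ 3) * d\<^sup>2"
proof -
  \<comment> \<open>This is \<open>e - q\<close>, the effect of moving the argument.\<close>
  define s where "s = 2 * d * w * D - r"
  have q1: "\<bar>q\<bar> \<le> 1" using w Z by auto
  have K: "0 \<le> K" using D by simp
  have "2 * d * w * D \<le> 2 * d * 1 * K"
    using d w D by (intro mult_mono) auto
  moreover have "0 \<le> 2 * d * w * D" using d w D by simp
  ultimately have s: "\<bar>s\<bar> \<le> 2 * d * K + 16 * K\<^sup>2 * d\<^sup>2"
    unfolding s_def using r by linarith
  have prod: "\<bar>q * y\<bar> \<le> c" if "\<bar>y\<bar> \<le> c" for y c
    using mult_mono[OF q1 that] by (simp add: abs_mult)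
  have e2: "e\<^sup>2 = q\<^sup>2 + 2 * (q * s) + s\<^sup>2"
    unfolding e s_def by (simp add: power2_eq_square algebra_simps)
  have A: "2 * q * m1 \<le> 4 * d * D * q * Z + 16 * K\<^sup>2 * d\<^sup>2"
    using prod[OF m1] by (simp add: algebra_simps abs_le_iff)
  have B: "q\<^sup>2 \<le> e\<^sup>2 - 4 * d * w * D * q + 32 * K\<^sup>2 * d\<^sup>2"
  proof -
    have "q\<^sup>2 \<le> e\<^sup>2 - 2 * (q * s)" using e2 by simp
    also have "\<dots> = e\<^sup>2 - 4 * d * w * D * q + 2 * (q * r)"
      by (simp add: s_def algebra_simps)
    finally show ?thesis using prod[OF r] by (simp add: abs_le_iff)
  qed
  have C: "4 * d * D * q * Z - 4 * d * w * D * q = 4 * d * D * q\<^sup>2"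
    unfolding Z(3) by (simp add: algebra_simps power2_eq_square)
  have "q\<^sup>2 \<le> e\<^sup>2 + 2 * (2 * d * K + 16 * K\<^sup>2 * d\<^sup>2)"
  proof -
    define y where "y = 2 * d * K + 16 * K\<^sup>2 * d\<^sup>2"
    have "- (q * s) \<le> y"
      using prod[OF s] by (simp only: abs_le_iff y_def)
    then show ?thesis using e2 zero_le_power2[of s] unfolding y_def[symmetric] by linarith
  qed
  then have "4 * d * D * q\<^sup>2 \<le> 4 * d * K * (e\<^sup>2 + 2 * (2 * d * K + 16 * K\<^sup>2 * d\<^sup>2))"
    using d D by (intro mult_mono) auto
  also have "\<dots> = 4 * K * d * e\<^sup>2 + 16 * K\<^sup>2 * d\<^sup>2 + 128 * K ^ 3 * d\<^sup>2 * d"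
    by (simp add: algebra_simps power2_eq_square power3_eq_cube)
  also have "128 * K ^ 3 * d\<^sup>2 * d \<le> 128 * K ^ 3 * d\<^sup>2 * 1"
    using d K by (intro mult_left_mono) auto
  finally have "4 * d * D * q\<^sup>2 \<le> 4 * K * d * e\<^sup>2 + 16 * K\<^sup>2 * d\<^sup>2 + 128 * K ^ 3 * d\<^sup>2" by simp
  with A B C m2 show ?thesis by (simp add: algebra_simps)
qed

lemma pair_step_second_moment:
  fixes x x0 w :: real
  assumes n: "n \<ge> 1" and l: "l \<ge> 2" and x0: "x0 > 0" and x: "x \<ge> x0" and w: "0 \<le> w" "w \<le> 1"
  defines "K \<equiv> 1 / x0"
  shows "mean (choices l n) (\<lambda>v. (gap n (add_pair (v 1) (v 2) G) x - w)\<^sup>2)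
           \<le> (1 + 4 * K / real n) * (gap n G (x + 2 * w / real n) - w)\<^sup>2
               + (68 * K\<^sup>2 + 128 * K ^ 3) / (real n)\<^sup>2"
proof -
  define d where "d = 1 / real n"
  define q where "q = gap n G x - w"
  define D where "D = slope n G x"
  define Z where "Z = gap n G x"
  define h where "h = 2 * w / real n"
  define e where "e = gap n G (x + h) - w"
  define m1 where "m1 = mean (choices l n) (\<lambda>v. gap_incr n G x (v 1) (v 2))"
  define m2 where "m2 = mean (choices l n) (\<lambda>v. (gap_incr n G x (v 1) (v 2))\<^sup>2)"
  have x': "x > 0" using x x0 by simp
  have Kx: "1 / x \<le> K" "0 \<le> 1 / x" "0 \<le> K"
    using x x0 by (auto simp: K_def frac_le)
  have Kx2: "1 / x\<^sup>2 \<le> K\<^sup>2"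
    using power_mono[OF Kx(1,2), of 2] by (simp add: power_divide)
  have d: "0 < d" "d \<le> 1" using n by (auto simp: d_def)
  have h: "h = 2 * d * w" "h \<ge> 0" using w by (auto simp: h_def d_def)
  have D: "0 \<le> D" "D \<le> K"
    using slope_bounds[OF x', of n G] Kx by (auto simp: D_def)
  have "\<bar>(q + 2 * d * w * D) - e\<bar> \<le> 4 * h\<^sup>2 / x\<^sup>2"
    using gap_shift[OF x' h(2), of n G] unfolding q_def e_def D_def h(1)
    by (simp add: abs_minus_commute algebra_simps)
  also have "\<dots> = 16 * (1 / x\<^sup>2) * d\<^sup>2 * w\<^sup>2"
    by (simp add: h power_mult_distrib)
  also have "\<dots> \<le> 16 * K\<^sup>2 * d\<^sup>2 * 1"
    using w Kx2 by (intro mult_mono power_le_one) auto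
  finally have r: "\<bar>(q + 2 * d * w * D) - e\<bar> \<le> 16 * K\<^sup>2 * d\<^sup>2" by simp
  have "\<bar>m1 - 2 * d * D * Z\<bar> \<le> 8 / (x\<^sup>2 * (real n)\<^sup>2)"
    using average_gap_incr[OF n x', of G]
    unfolding m1_def mean_choices_first_two[OF l n] d_def D_def Z_def by simp
  also have "\<dots> = 8 * (1 / x\<^sup>2) * d\<^sup>2" by (simp add: d_def power_divide)
  also have "\<dots> \<le> 8 * K\<^sup>2 * d\<^sup>2"
    using Kx2 by (intro mult_right_mono mult_left_mono) auto
  finally have m1: "\<bar>m1 - 2 * d * D * Z\<bar> \<le> 8 * K\<^sup>2 * d\<^sup>2" .
  have mem: "v 1 \<in> {1..n}" "v 2 \<in> {1..n}" if "v \<in> choices l n" for v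
    using that l by (auto simp: choices_def PiE_iff)
  have "m2 \<le> mean (choices l n) (\<lambda>v. 4 * K\<^sup>2 * d\<^sup>2)"
    unfolding m2_def
  proof (rule mean_mono)
    fix v assume v: "v \<in> choices l n"
    have "gap_incr n G x (v 1) (v 2) \<le> 2 * (1 / x) * d"
      using gap_incr_bounds(2)[OF mem[OF v] x', of G] by (simp add: d_def)
    also have "\<dots> \<le> 2 * K * d"
      using d Kx by (intro mult_right_mono mult_left_mono) auto
    finally have "(gap_incr n G x (v 1) (v 2))\<^sup>2 \<le> (2 * K * d)\<^sup>2"
      using gap_incr_bounds(1)[OF mem[OF v] x', of G] by (intro power_mono) auto
    then show "(gap_incr n G x (v 1) (v 2))\<^sup>2 \<le> 4 * K\<^sup>2 * d\<^sup>2"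
      by (simp add: power_mult_distrib)
  qed
  then have m2: "m2 \<le> 4 * K\<^sup>2 * d\<^sup>2"
    using choices_nonempty[OF n, of l] by (simp add: mean_const)
  have "mean (choices l n) (\<lambda>v. (gap n (add_pair (v 1) (v 2) G) x - w)\<^sup>2)
          = mean (choices l n) (\<lambda>v. q\<^sup>2 + (2 * q * gap_incr n G x (v 1) (v 2) + (gap_incr n G x (v 1) (v 2))\<^sup>2))"
    by (rule mean_cong) (simp add: q_def gap_incr_def power2_eq_square algebra_simps)
  also have "\<dots> = q\<^sup>2 + 2 * q * m1 + m2"
    using choices_nonempty[OF n, of l] unfolding mean_add mean_cmult m1_def m2_def
    by (simp add: mean_const)
  also have "\<dots> \<le> (1 + 4 * K * d) * e\<^sup>2 + (68 * K\<^sup>2 + 128 * K ^ 3) * d\<^sup>2"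
    using d D w r m1 m2 gap_bounds(1)[of x n G] gap_bounds(2)[of n G x] x'
    by (intro second_moment_step[where r = "(q + 2 * d * w * D) - e" and w = w and D = D and Z = Z])
       (auto simp: Z_def q_def)
  finally show ?thesis
    by (simp add: d_def e_def h_def power_divide)
qed

lemma affine_recurrence_bound:
  fixes E :: "nat \<Rightarrow> real"
  assumes "E 0 = 0" "\<And>i. Suc i \<le> m \<Longrightarrow> E (Suc i) \<le> a * E i + b" "a \<ge> 1" "b \<ge> 0" "i \<le> m"
  shows "E i \<le> a ^ i * (real i * b)"
  using assms(5)
proof (induction i)
  case (Suc i)
  have "E (Suc i) \<le> a * E i + b"
    using assms(2) Suc.prems by blast
  also have "a * E i \<le> a * (a ^ i * (real i * b))"
    using Suc assms(3) by (intro mult_left_mono) auto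
  finally have "E (Suc i) \<le> a * (a ^ i * (real i * b)) + b" by simp
  moreover have "b \<le> a ^ Suc i * b"
    using mult_right_mono[OF one_le_power[OF assms(3), of "Suc i"] assms(4)] by simp
  ultimately show ?case by (simp add: algebra_simps)
qed (simp add: assms(1))

text \<open>
  Along the line \<open>x\<^sub>i = y - 2 i w / n\<close> the deviation starts at 0, and each step multiplies its second
  moment by at most \<open>1 + B/n\<close> and adds at most \<open>B/n\<^sup>2\<close>. The line stays above \<open>y - w > 0\<close> during the
  first \<open>n/2\<close> steps, and therefore the bounds on the slope hold with the same constant throughout.
\<close>

lemma gap_second_moment:
  fixes y :: real
  assumes n: "n \<ge> 1" and l: "l \<ge> 2" and y: "y > 0"
    and T: "n div 2 \<le> T"
  defines "w \<equiv> 1 - exp (- y)"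
  defines "K \<equiv> 1 / (y - w)"
  defines "B \<equiv> 4 * K + 68 * K\<^sup>2 + 128 * K ^ 3"
  shows "mean (samples l n T)
           (\<lambda>\<omega>. (gap n (C_graph pick n (n div 2) \<omega>) (y - 2 * real (n div 2) * w / real n) - w)\<^sup>2)
           \<le> exp B * B / real n"
proof -
  define E where "E i = mean (samples l n T)
           (\<lambda>\<omega>. (gap n (C_graph pick n i \<omega>) (y - 2 * real i * w / real n) - w)\<^sup>2)" for i
  have w: "0 \<le> w" "w \<le> 1" using y by (auto simp: w_def)
  have x0: "y - w > 0"
  proof (cases "y \<le> 2")
    case True
    have "0 < y\<^sup>2 / 4" using y by simp
    also have "\<dots> \<le> y - w" using quadratic_le_exp_neg[of y] True y by (simp add: w_def)
    finally show ?thesis .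
  next
    case False
    then show ?thesis using exp_gt_zero[of "- y"] unfolding w_def by linarith
  qed
  have K: "K \<ge> 0" using x0 by (simp add: K_def)
  have B: "B \<ge> 0" using K by (simp add: B_def)
  have step: "E (Suc i) \<le> (1 + B / real n) * E i + B / (real n)\<^sup>2" if i: "Suc i \<le> n div 2" for i
  proof -
    define x where "x = y - 2 * real (Suc i) * w / real n"
    have xi: "y - 2 * real i * w / real n = x + 2 * w / real n"
      by (simp add: x_def distrib_left distrib_right add_divide_distrib)
    have "2 * real (Suc i) \<le> real n"
    proof -
      have "2 * Suc i \<le> n" using i by presburger
      then show ?thesis by linarith
    qed
    then have "2 * real (Suc i) * w / real n \<le> w"
      using n w mult_right_mono[of "2 * real (Suc i)" "real n" w]
      by (simp add: pos_divide_le_eq mult.commute del: of_nat_Suc)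
    then have x: "x \<ge> y - w" by (simp add: x_def)
    have "E (Suc i) = mean (samples l n T) (\<lambda>\<omega>. mean (choices l n) (\<lambda>v.
            (gap n (next_graph pick n i (C_graph pick n i \<omega>) v) x - w)\<^sup>2))"
      unfolding E_def x_def[symmetric]
      by (rule mean_one_step[where h = 0 and H = "\<lambda>_ G. (gap n G x - w)\<^sup>2"]) (use i T n in auto)
    also have "\<dots> = mean (samples l n T) (\<lambda>\<omega>. mean (choices l n) (\<lambda>v.
            (gap n (add_pair (v 1) (v 2) (C_graph pick n i \<omega>)) x - w)\<^sup>2))"
      using i by (simp add: next_graph_def)
    also have "\<dots> \<le> mean (samples l n T) (\<lambda>\<omega>.
            (1 + B / real n) * (gap n (C_graph pick n i \<omega>) (x + 2 * w / real n) - w)\<^sup>2 + B / (real n)\<^sup>2)"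
    proof (rule mean_mono)
      fix \<omega>
      let ?e = "(gap n (C_graph pick n i \<omega>) (x + 2 * w / real n) - w)\<^sup>2"
      have "(1 + 4 * K / real n) * ?e + (68 * K\<^sup>2 + 128 * K ^ 3) / (real n)\<^sup>2
              \<le> (1 + B / real n) * ?e + B / (real n)\<^sup>2"
        using K by (intro add_mono mult_right_mono divide_right_mono) (auto simp: B_def intro!: divide_right_mono)
      then show "mean (choices l n) (\<lambda>v. (gap n (add_pair (v 1) (v 2) (C_graph pick n i \<omega>)) x - w)\<^sup>2)
              \<le> (1 + B / real n) * ?e + B / (real n)\<^sup>2"
        using pair_step_second_moment[OF n l x0 x w, of "C_graph pick n i \<omega>"] unfolding K_def by linarith
    qed
    also have "\<dots> = (1 + B / real n) * E i + B / (real n)\<^sup>2"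
      unfolding E_def xi mean_add mean_cmult using samples_nonempty[OF n] by (simp add: mean_const)
    finally show ?thesis .
  qed
  have E0: "E 0 = 0"
  proof -
    have "component n {} v = {v}" if "v \<in> {1..n}" for v
      using that by (auto simp: component_def)
    then have "gap n {} y = w"
      using n by (simp add: gap_def comp_size_def w_def)
    then show ?thesis
      using samples_nonempty[OF n] by (simp add: E_def mean_const)
  qed
  have a: "1 + B / real n \<ge> 1" using B by simp
  have iter: "E i \<le> (1 + B / real n) ^ i * (real i * (B / (real n)\<^sup>2))" if "i \<le> n div 2" for i
    using affine_recurrence_bound[of E "n div 2" "1 + B / real n" "B / (real n)\<^sup>2" i] E0 step a B that
    by simp
  have "(1 + B / real n) ^ (n div 2) \<le> (1 + B / real n) ^ n"
    using a by (intro power_increasing) auto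
  also have "\<dots> \<le> exp (B / real n) ^ n"
    using a by (intro power_mono exp_ge_add_one_self) auto
  also have "\<dots> = exp B"
    using n by (simp flip: exp_of_nat_mult)
  finally have pw: "(1 + B / real n) ^ (n div 2) \<le> exp B" .
  have "E (n div 2) \<le> (1 + B / real n) ^ (n div 2) * (real (n div 2) * (B / (real n)\<^sup>2))"
    by (rule iter) simp
  also have "\<dots> \<le> exp B * (real n * (B / (real n)\<^sup>2))"
    using B pw a by (intro mult_mono) auto
  also have "\<dots> = exp B * B / real n"
    using n by (simp add: power2_eq_square)
  finally show ?thesis by (simp add: E_def)
qed

lemma mean_of_bool_le_second_moment:
  assumes "\<epsilon> > 0"
  shows "mean A (\<lambda>x. of_bool (\<bar>f x\<bar> > \<epsilon>)) \<le> mean A (\<lambda>x. (f x)\<^sup>2) / \<epsilon>\<^sup>2"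
proof -
  have "mean A (\<lambda>x. of_bool (\<bar>f x\<bar> > \<epsilon>)) \<le> mean A (\<lambda>x. (1 / \<epsilon>\<^sup>2) * (f x)\<^sup>2)"
  proof (rule mean_mono)
    fix x
    show "of_bool (\<bar>f x\<bar> > \<epsilon>) \<le> (1 / \<epsilon>\<^sup>2) * (f x)\<^sup>2"
      using assms power_mono[of \<epsilon> "\<bar>f x\<bar>" 2] by (auto simp: field_simps)
  qed
  then show ?thesis unfolding mean_cmult by simp
qed

lemma gap_concentration:
  fixes y :: real
  assumes l: "l \<ge> 2" and y: "y > 0" and \<epsilon>: "\<epsilon> > 0" and T: "\<And>n. n div 2 \<le> T n"
  defines "w \<equiv> 1 - exp (- y)"
  shows "(\<lambda>n. mean (samples l n (T n)) (\<lambda>\<omega>.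
            of_bool (\<bar>gap n (C_graph pick n (n div 2) \<omega>) (y - 2 * real (n div 2) * w / real n) - w\<bar> > \<epsilon>)))
           \<longlonglongrightarrow> 0"
proof -
  define B where "B = (let K = 1 / (y - w) in 4 * K + 68 * K\<^sup>2 + 128 * K ^ 3)"
  show ?thesis
  proof (rule tendsto_sandwich[where f = "\<lambda>_. 0" and h = "\<lambda>n. exp B * B / real n / \<epsilon>\<^sup>2"])
    show "\<forall>\<^sub>F n in sequentially. mean (samples l n (T n)) (\<lambda>\<omega>.
            of_bool (\<bar>gap n (C_graph pick n (n div 2) \<omega>) (y - 2 * real (n div 2) * w / real n) - w\<bar> > \<epsilon>))
            \<le> exp B * B / real n / \<epsilon>\<^sup>2"
      using eventually_ge_at_top[of 1]
    proof eventually_elim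
      case (elim n)
      show ?case
        by (rule order_trans[OF mean_of_bool_le_second_moment[OF \<epsilon>] divide_right_mono])
           (use gap_second_moment[OF elim l y T, of pick] in \<open>simp_all add: w_def B_def Let_def\<close>)
    qed
    show "(\<lambda>n. exp B * B / real n / \<epsilon>\<^sup>2) \<longlonglongrightarrow> 0"
      by (intro tendsto_divide_zero[OF lim_const_over_n])
    show "\<forall>\<^sub>F n in sequentially. 0 \<le> mean (samples l n (T n)) (\<lambda>\<omega>.
            of_bool (\<bar>gap n (C_graph pick n (n div 2) \<omega>) (y - 2 * real (n div 2) * w / real n) - w\<bar> > \<epsilon>))"
      by (intro always_eventually allI mean_nonneg) simp
  qed simp
qed

lemma S_eq_average:
  assumes "n \<ge> 1"
  shows "S n G = (\<Sum>v = 1..n. real (comp_size n G v)) / real n"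
proof -
  have "(\<Sum>v = 1..n. real (comp_size n G v))
          = (\<Sum>k = 1..n. \<Sum>v | v \<in> {1..n} \<and> comp_size n G v = k. real (comp_size n G v))"
    using comp_size_pos[of _ n G] comp_size_le[of n G]
    by (intro sum.group[symmetric]) auto
  also have "\<dots> = (\<Sum>k = 1..n. real k * real (N n G k))"
    by (intro sum.cong refl) (simp add: N_def)
  finally show ?thesis
    by (simp add: S_def sum_divide_distrib)
qed

lemma gap_le_S:
  assumes "n \<ge> 1" "x \<ge> 0"
  shows "gap n G x \<le> x * S n G"
proof -
  have "(\<Sum>v = 1..n. 1 - exp (- (x * real (comp_size n G v)))) \<le> (\<Sum>v = 1..n. x * real (comp_size n G v))"
    using assms by (intro sum_mono one_minus_exp_neg_bounds(2)) auto
  then show ?thesis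
    using assms by (simp add: gap_def S_eq_average sum_distrib_left divide_right_mono)
qed

definition large :: "nat \<Rightarrow> graph \<Rightarrow> nat \<Rightarrow> nat" where
  "large n G k = card {v \<in> {1..n}. k \<le> comp_size n G v}"

lemma large_eq_sum: "real (large n G k) = (\<Sum>v = 1..n. of_bool (k \<le> comp_size n G v))"
  by (simp add: large_def of_bool_def sum.If_cases Int_def)

lemma large_le: "large n G k \<le> n"
proof -
  have "large n G k \<le> card {1..n}"
    unfolding large_def by (rule card_mono) auto
  then show ?thesis by simp
qed

lemma large_le_gap:
  assumes "n \<ge> 1" "x \<ge> 0"
  shows "real (large n G k) * (1 - exp (- (x * real k))) \<le> real n * gap n G x"
proof -
  have "real (large n G k) * (1 - exp (- (x * real k)))
          = (\<Sum>v = 1..n. of_bool (k \<le> comp_size n G v) * (1 - exp (- (x * real k))))"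
    by (simp add: large_eq_sum sum_distrib_right)
  also have "\<dots> \<le> (\<Sum>v = 1..n. 1 - exp (- (x * real (comp_size n G v))))"
    using assms by (intro sum_mono) (auto simp: mult_left_mono)
  also have "\<dots> = real n * gap n G x"
    using assms by (simp add: gap_def)
  finally show ?thesis .
qed

text \<open>
  From \<open>S \<ge> W x / x\<close> with \<open>x \<le> 2 y\<^sup>2\<close> and \<open>W x \<ge> y/4\<close> whp; the number \<open>y\<close> is fixed, but
  as small as desired.
\<close>

lemma critical_S_unbounded:
  assumes l: "l \<ge> 2" and T: "\<And>n. n div 2 \<le> T n" and C: "C > 0"
  shows "(\<lambda>n. mean (samples l n (T n)) (\<lambda>\<omega>. of_bool (S n (C_graph pick n (n div 2) \<omega>) \<le> C))) \<longlonglongrightarrow> 0"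
proof -
  \<comment> \<open>The bound obtained is \<open>S \<ge> 1 / (8 y)\<close>, which exceeds \<open>C\<close> for this \<open>y\<close>.\<close>
  define y where "y = min (1 / 2) (1 / (16 * C))"
  define w where "w = 1 - exp (- y)"
  have y: "0 < y" "y \<le> 1 / 2" "16 * C * y \<le> 1"
    using C by (auto simp: y_def min_def field_simps)
  have w: "y - y\<^sup>2 \<le> w" "w \<le> y" "0 \<le> w" "w \<le> 1"
    using one_minus_exp_neg_bounds[of y] y by (auto simp: w_def)
  have y2: "y\<^sup>2 \<le> y / 2"
    using mult_left_mono[OF y(2), of y] y(1) by (simp add: power2_eq_square)
  show ?thesis
  proof (rule mean_of_bool_tendsto_0_mono)
    show "(\<lambda>n. mean (samples l n (T n)) (\<lambda>\<omega>. of_bool (\<bar>gap n (C_graph pick n (n div 2) \<omega>)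
             (y - 2 * real (n div 2) * w / real n) - w\<bar> > y / 4))) \<longlonglongrightarrow> 0"
      unfolding w_def using l y T by (intro gap_concentration) auto
    show "\<forall>\<^sub>F n in sequentially. \<forall>\<omega>. S n (C_graph pick n (n div 2) \<omega>) \<le> C \<longrightarrow>
            \<bar>gap n (C_graph pick n (n div 2) \<omega>) (y - 2 * real (n div 2) * w / real n) - w\<bar> > y / 4"
      using eventually_ge_at_top[of "max 1 (nat \<lceil>1 / y\<rceil>)"]
    proof eventually_elim
      case (elim n)
      then have n: "n \<ge> 1" and "real n \<ge> 1 / y" by (simp, linarith)
      then have ny: "1 / real n \<le> y"
        using y by (simp add: field_simps)
      define x where "x = y - 2 * real (n div 2) * w / real n"
      \<comment> \<open>For odd \<open>n\<close> the line stops short of \<open>y - w\<close> by \<open>w/n\<close>, which is at most \<open>y\<^sup>2\<close>.\<close>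
      have "2 * real (n div 2) \<le> real n" "real n - 1 \<le> 2 * real (n div 2)"
        by linarith+
      then have "2 * real (n div 2) * w / real n \<le> w" "(real n - 1) * w / real n \<le> 2 * real (n div 2) * w / real n"
        using n w mult_right_mono[of "2 * real (n div 2)" "real n" w]
        by (auto simp: pos_divide_le_eq mult.commute intro!: divide_right_mono mult_left_mono)
      moreover have "(real n - 1) * w / real n = w - w * (1 / real n)"
        using n by (simp add: field_simps)
      moreover have "w * (1 / real n) \<le> y * y"
        using w ny y by (intro mult_mono) auto
      ultimately have x: "0 \<le> x" "x \<le> 2 * y\<^sup>2"
        using w by (auto simp: x_def power2_eq_square)
      show ?case
      proof (intro allI impI, rule ccontr)
        fix \<omega>
        let ?G = "C_graph pick n (n div 2) \<omega>"
        assume S: "S n ?G \<le> C" and "\<not> \<bar>gap n ?G (y - 2 * real (n div 2) * w / real n) - w\<bar> > y / 4"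
        then have "y / 4 \<le> gap n ?G x"
          using w y2 unfolding x_def[symmetric] by linarith
        also have "\<dots> \<le> x * S n ?G"
          using n x by (intro gap_le_S) auto
        also have "\<dots> \<le> x * C"
          using S x by (intro mult_left_mono) auto
        also have "\<dots> \<le> 2 * y\<^sup>2 * C"
          using x C by (intro mult_right_mono) auto
        also have "\<dots> = (16 * C * y) * y / 8"
          by (simp add: power2_eq_square)
        also have "\<dots> \<le> 1 * y / 8"
          using y by (intro divide_right_mono mult_right_mono) auto
        finally show False using y by simp
      qed
    qed
  qed
qed

text \<open>
  With \<open>y = 2 / 2 ^ j\<close> the line ends at some \<open>x \<ge> y\<^sup>2 / 4 = 1 / 4 ^ j\<close>, so a vertex in a component of
  size at least \<open>4 ^ j\<close> contributes at least \<open>1 - 1/e \<ge> 1/2\<close> to a sum that is at most \<open>2 y n\<close>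
  whp.
\<close>

lemma critical_large_bound:
  assumes l: "l \<ge> 2" and T: "\<And>n. n div 2 \<le> T n" and j: "j \<ge> 1"
  shows "(\<lambda>n. mean (samples l n (T n)) (\<lambda>\<omega>.
            of_bool (real (large n (C_graph pick n (n div 2) \<omega>) (4 ^ j)) > 8 / 2 ^ j * real n))) \<longlonglongrightarrow> 0"
proof -
  define y :: real where "y = 2 / 2 ^ j"
  define w where "w = 1 - exp (- y)"
  have "(2::real) ^ 1 \<le> 2 ^ j"
    using j by (intro power_increasing) auto
  then have y: "0 < y" "y \<le> 1" by (auto simp: y_def)
  have w: "w \<le> y" "0 \<le> w" "y\<^sup>2 / 4 \<le> y - w"
    using one_minus_exp_neg_bounds[of y] quadratic_le_exp_neg[of y] y by (auto simp: w_def)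
  have yj: "y\<^sup>2 / 4 = 1 / 4 ^ j"
    by (simp add: y_def power_divide flip: power_mult_distrib power2_eq_square)
       (simp add: power2_eq_square flip: power_mult_distrib)
  show ?thesis
  proof (rule mean_of_bool_tendsto_0_mono)
    show "(\<lambda>n. mean (samples l n (T n)) (\<lambda>\<omega>. of_bool (\<bar>gap n (C_graph pick n (n div 2) \<omega>)
             (y - 2 * real (n div 2) * w / real n) - w\<bar> > y))) \<longlonglongrightarrow> 0"
      unfolding w_def using l y T by (intro gap_concentration) auto
    show "\<forall>\<^sub>F n in sequentially. \<forall>\<omega>. real (large n (C_graph pick n (n div 2) \<omega>) (4 ^ j)) > 8 / 2 ^ j * real n \<longrightarrow>
            \<bar>gap n (C_graph pick n (n div 2) \<omega>) (y - 2 * real (n div 2) * w / real n) - w\<bar> > y"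
      using eventually_ge_at_top[of 1]
    proof eventually_elim
      case (elim n)
      define x where "x = y - 2 * real (n div 2) * w / real n"
      have "2 * real (n div 2) \<le> real n"
        by linarith
      then have "2 * real (n div 2) * w / real n \<le> w"
        using elim w mult_right_mono[of "2 * real (n div 2)" "real n" w]
        by (simp add: pos_divide_le_eq mult.commute)
      then have x: "1 / 4 ^ j \<le> x" "0 \<le> x"
        using w yj by (auto simp: x_def intro: order_trans[of 0 "y\<^sup>2 / 4"])
      have "exp (- (x * real (4 ^ j))) \<le> exp (- 1)"
        using x by (simp add: field_simps)
      also have "\<dots> \<le> 1 / (2::real)"
        using exp_ge_add_one_self[of "1::real"] by (simp add: exp_minus field_simps)
      finally have half: "1 / 2 \<le> 1 - exp (- (x * real (4 ^ j)))" by simp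
      show ?case
      proof (intro allI impI, rule ccontr)
        fix \<omega>
        let ?G = "C_graph pick n (n div 2) \<omega>"
        assume big: "real (large n ?G (4 ^ j)) > 8 / 2 ^ j * real n"
          and "\<not> \<bar>gap n ?G (y - 2 * real (n div 2) * w / real n) - w\<bar> > y"
        then have g: "gap n ?G x \<le> 2 * y"
          using w unfolding x_def[symmetric] by linarith
        have "real (large n ?G (4 ^ j)) * (1 / 2) \<le> real (large n ?G (4 ^ j)) * (1 - exp (- (x * real (4 ^ j))))"
          using half by (intro mult_left_mono) auto
        also have "\<dots> \<le> real n * gap n ?G x"
          using elim x by (intro large_le_gap) auto
        also have "\<dots> \<le> real n * (2 * y)"
          using g by (intro mult_left_mono) auto
        finally show False using big by (simp add: y_def)
      qed
    qed
  qed
qed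

section \<open>Growth of large components under the rule joining the two smallest\<close>

text \<open>
  If the new component reaches size \<open>k\<close>, then one of its two parts has size at least \<open>k/2\<close>. Only parts
  smaller than \<open>k\<close> bring in new vertices.
\<close>

lemma large_add_pair:
  assumes "a \<in> {1..n}" "b \<in> {1..n}"
  shows "large n G k \<le> large n (add_pair a b G) k" (is ?mono)
    and "real (large n (add_pair a b G) k) \<le> real (large n G k)
           + (if k \<le> 2 * max (comp_size n G a) (comp_size n G b) then 2 * real k else 0)" (is ?incr)
proof -
  define \<alpha> \<beta> where "\<alpha> = comp_size n G a" and "\<beta> = comp_size n G b"
  let ?g = "\<lambda>c. of_bool (k \<le> c) :: real"
  have eq: "real (large n (add_pair a b G) k) = real (large n G k) +
           (if component n G a = component n G b then 0
            else real (\<alpha> + \<beta>) * ?g (\<alpha> + \<beta>) - real \<alpha> * ?g \<alpha> - real \<beta> * ?g \<beta>)"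
    unfolding large_eq_sum \<alpha>_def \<beta>_def by (rule sum_comp_size_add_pair[OF assms])
  have "real (large n G k) \<le> real (large n (add_pair a b G) k)"
    unfolding eq by (auto split: if_splits)
  then show ?mono by simp
  show ?incr
    unfolding eq \<alpha>_def[symmetric] \<beta>_def[symmetric] by (auto simp: max_def)
qed

definition nearly_all_in :: "nat \<Rightarrow> nat set \<Rightarrow> (nat \<Rightarrow> nat) \<Rightarrow> bool" where
  "nearly_all_in l B v \<longleftrightarrow> (\<exists>i\<in>{1..l}. \<forall>j\<in>{1..l} - {i}. v j \<in> B)"

lemma PiE_all_but_one:
  assumes "B \<subseteq> A" "i \<in> I"
  shows "{v \<in> I \<rightarrow>\<^sub>E A. \<forall>j\<in>I - {i}. v j \<in> B} = Pi\<^sub>E I (\<lambda>j. if j = i then A else B)"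
  using assms by (auto simp: PiE_iff extensional_def subset_iff split: if_splits) metis

text \<open>
  A union bound over the exceptional index; \<open>l \<ge> 4\<close> makes the exponent at least 3.
\<close>

lemma mean_nearly_all_in:
  assumes n: "n \<ge> 1" and l: "l \<ge> 4" and B: "B \<subseteq> {1..n}"
  shows "mean (choices l n) (\<lambda>v. of_bool (nearly_all_in l B v)) \<le> real l * (real (card B) / real n) ^ 3"
proof -
  have fB: "finite B" using B finite_subset by blast
  have cB: "card B \<le> n" using card_mono[OF _ B] by simp
  have one: "(\<Sum>v\<in>choices l n. of_bool (\<forall>j\<in>{1..l} - {i}. v j \<in> B)) = real n * real (card B) ^ (l - 1)"
    if i: "i \<in> {1..l}" for i
  proof -
    have "{v \<in> choices l n. \<forall>j\<in>{1..l} - {i}. v j \<in> B} = Pi\<^sub>E {1..l} (\<lambda>j. if j = i then {1..n} else B)"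
      unfolding choices_def by (rule PiE_all_but_one[OF B i])
    then have "card {v \<in> choices l n. \<forall>j\<in>{1..l} - {i}. v j \<in> B}
                 = (\<Prod>j\<in>{1..l}. card (if j = i then {1..n} else B))"
      by (simp add: card_PiE)
    also have "\<dots> = n * (\<Prod>j\<in>{1..l} - {i}. card B)"
      using i by (subst prod.remove[of _ i]) (auto intro!: prod.cong)
    also have "\<dots> = n * card B ^ (l - 1)"
      using i by simp
    finally show ?thesis
      by (simp add: of_bool_def sum.If_cases Int_def)
  qed
  have "mean (choices l n) (\<lambda>v. of_bool (nearly_all_in l B v))
          \<le> mean (choices l n) (\<lambda>v. \<Sum>i = 1..l. of_bool (\<forall>j\<in>{1..l} - {i}. v j \<in> B))"
  proof (rule mean_mono)
    fix v
    show "of_bool (nearly_all_in l B v) \<le> (\<Sum>i = 1..l. of_bool (\<forall>j\<in>{1..l} - {i}. v j \<in> B) :: real)"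
    proof (cases "nearly_all_in l B v")
      case True
      then obtain i where i: "i \<in> {1..l}" "\<forall>j\<in>{1..l} - {i}. v j \<in> B"
        by (auto simp: nearly_all_in_def)
      then have "(1::real) = of_bool (\<forall>j\<in>{1..l} - {i}. v j \<in> B)" by simp
      also have "\<dots> \<le> (\<Sum>i = 1..l. of_bool (\<forall>j\<in>{1..l} - {i}. v j \<in> B))"
        using i(1) by (intro member_le_sum) auto
      finally show ?thesis using True by simp
    qed (auto intro!: sum_nonneg)
  qed
  also have "\<dots> = (\<Sum>i = 1..l. real n * real (card B) ^ (l - 1)) / real n ^ l"
    unfolding mean_def card_choices of_nat_power
    by (subst sum.swap, intro arg_cong[where f = "\<lambda>x. x / real n ^ l"] sum.cong refl one)
  also have "\<dots> = real l * (real (card B) / real n) ^ (l - 1)"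
    using n l by (cases l) (simp_all add: power_divide)
  also have "\<dots> \<le> real l * (real (card B) / real n) ^ 3"
    using n l cB by (intro mult_left_mono power_decreasing) auto
  finally show ?thesis .
qed

text \<open>
  In both phases an edge between two vertices of \<open>[n]\<close> is added. In the second phase the other
  chosen vertices lie in components at least as large as the two that are joined, so all
  of them except possibly the endpoint in the smaller one lie in components of size at least \<open>m\<close>
  as soon as the larger one does.
\<close>

lemma next_graph_add_pair:
  assumes M: "M_rule l pick" and l: "l \<ge> 2" and v: "v \<in> choices l n"
  obtains a b where "next_graph pick n i G v = add_pair a b G" "a \<in> {1..n}" "b \<in> {1..n}"
    "\<not> Suc i \<le> n div 2 \<Longrightarrow> max (comp_size n G a) (comp_size n G b) \<ge> m \<Longrightarrow>
       nearly_all_in l {u \<in> {1..n}. m \<le> comp_size n G u} v"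
proof -
  have mem: "v j \<in> {1..n}" if "j \<in> {1..l}" for j
    using that v by (auto simp: choices_def PiE_iff)
  show ?thesis
  proof (cases "Suc i \<le> n div 2")
    case True
    show ?thesis
      by (rule that[of "v 1" "v 2"]) (use True mem l in \<open>auto simp: next_graph_def\<close>)
  next
    case False
    obtain p q where pq: "pick n G v = (p, q)" by fastforce
    have two: "are_two_smallest l (\<lambda>j. comp_size n G (v j)) (p, q)"
      using M mem unfolding M_rule_def pq[symmetric] by blast
    then have p: "p \<in> {1..l}" "q \<in> {1..l}" "p \<noteq> q"
      and le: "\<And>j. j \<in> {1..l} - {p, q} \<Longrightarrow>
        comp_size n G (v p) \<le> comp_size n G (v j) \<and> comp_size n G (v q) \<le> comp_size n G (v j)"
      by (auto simp: are_two_smallest_def)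
    show ?thesis
    proof (rule that[of "v p" "v q"])
      show "next_graph pick n i G v = add_pair (v p) (v q) G"
        using False pq by (simp add: next_graph_def)
      assume "max (comp_size n G (v p)) (comp_size n G (v q)) \<ge> m"
      then consider "m \<le> comp_size n G (v p)" | "m \<le> comp_size n G (v q)"
        by (auto simp: max_def split: if_splits)
      then show "nearly_all_in l {u \<in> {1..n}. m \<le> comp_size n G u} v"
      proof cases
        case 1
        have "m \<le> comp_size n G (v j)" if "j \<in> {1..l} - {q}" for j
          using that 1 le[of j] by (cases "j = p") auto
        then show ?thesis
          unfolding nearly_all_in_def using p mem by (intro bexI[of _ q]) auto
      next
        case 2
        have "m \<le> comp_size n G (v j)" if "j \<in> {1..l} - {p}" for j
          using that 2 le[of j] by (cases "j = q") auto
        then show ?thesis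
          unfolding nearly_all_in_def using p mem by (intro bexI[of _ p]) auto
      qed
    qed (use p mem in auto)
  qed
qed

text \<open>
  An exponential moment of the number of vertices in components of size at least \<open>4 m\<close>. One step
  adds at most \<open>8 m\<close> such vertices, so it at most doubles the power. The indicator
  switches the moment off once the components of size at least \<open>m\<close> hold more than a fraction \<open>\<theta>\<close> of
  the vertices; as components only grow, it never switches on again.
\<close>

definition potential :: "nat \<Rightarrow> nat \<Rightarrow> real \<Rightarrow> graph \<Rightarrow> real" where
  "potential n m \<theta> G =
     of_bool (real (large n G m) \<le> \<theta> * real n) * 2 powr (real (large n G (4 * m)) / (8 * real m))"

lemma potential_nonneg: "0 \<le> potential n m \<theta> G"
  by (simp add: potential_def)

lemma potential_next_le:
  assumes M: "M_rule l pick" and l: "l \<ge> 2" and i: "\<not> Suc i \<le> n div 2" and m: "m \<ge> 1"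
    and v: "v \<in> choices l n"
  shows "potential n m \<theta> (next_graph pick n i G v)
           \<le> potential n m \<theta> G * (1 + of_bool (nearly_all_in l {u \<in> {1..n}. m \<le> comp_size n G u} v))"
proof -
  obtain a b where G': "next_graph pick n i G v = add_pair a b G"
    and ab: "a \<in> {1..n}" "b \<in> {1..n}"
    and near: "max (comp_size n G a) (comp_size n G b) \<ge> m \<Longrightarrow>
       nearly_all_in l {u \<in> {1..n}. m \<le> comp_size n G u} v"
    using next_graph_add_pair[OF M l v, of i G m] i by blast
  let ?near = "nearly_all_in l {u \<in> {1..n}. m \<le> comp_size n G u} v"
  let ?G' = "add_pair a b G"
  have mono: "large n G m \<le> large n ?G' m"
    by (rule large_add_pair(1)[OF ab])
  have incr: "real (large n ?G' (4 * m)) \<le> real (large n G (4 * m)) + of_bool ?near * (8 * real m)"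
    using large_add_pair(2)[OF ab, of G "4 * m"] near by (auto split: if_splits)
  then have "real (large n ?G' (4 * m)) / (8 * real m) \<le> real (large n G (4 * m)) / (8 * real m) + of_bool ?near"
    using m divide_right_mono[OF incr, of "8 * real m"] by (simp add: add_divide_distrib)
  then have "2 powr (real (large n ?G' (4 * m)) / (8 * real m))
               \<le> 2 powr (real (large n G (4 * m)) / (8 * real m) + of_bool ?near)"
    by (intro powr_mono) auto
  also have "\<dots> = 2 powr (real (large n G (4 * m)) / (8 * real m)) * (1 + of_bool ?near)"
    by (auto simp: powr_add)
  finally show ?thesis
    using mono unfolding G' potential_def by (auto simp: mult_ac)
qed

lemma potential_step:
  assumes M: "M_rule l pick" and l: "l \<ge> 4" and n: "n \<ge> 1" and i: "\<not> Suc i \<le> n div 2" and m: "m \<ge> 1"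
  shows "mean (choices l n) (\<lambda>v. potential n m \<theta> (next_graph pick n i G v))
           \<le> (1 + real l * \<theta> ^ 3) * potential n m \<theta> G"
proof (cases "real (large n G m) \<le> \<theta> * real n")
  case True
  let ?B = "{u \<in> {1..n}. m \<le> comp_size n G u}"
  have "mean (choices l n) (\<lambda>v. potential n m \<theta> (next_graph pick n i G v))
          \<le> mean (choices l n) (\<lambda>v. potential n m \<theta> G * (1 + of_bool (nearly_all_in l ?B v)))"
    using l by (intro mean_mono potential_next_le[OF M _ i m]) auto
  also have "\<dots> = potential n m \<theta> G * (1 + mean (choices l n) (\<lambda>v. of_bool (nearly_all_in l ?B v)))"
    unfolding mean_cmult mean_add using choices_nonempty[OF n] by (simp add: mean_const)
  also have "\<dots> \<le> potential n m \<theta> G * (1 + real l * \<theta> ^ 3)"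
  proof (intro mult_left_mono add_left_mono potential_nonneg)
    have "mean (choices l n) (\<lambda>v. of_bool (nearly_all_in l ?B v)) \<le> real l * (real (card ?B) / real n) ^ 3"
      by (rule mean_nearly_all_in[OF n l]) auto
    also have "\<dots> \<le> real l * \<theta> ^ 3"
      using True n by (intro mult_left_mono power_mono) (auto simp: large_def field_simps)
    finally show "mean (choices l n) (\<lambda>v. of_bool (nearly_all_in l ?B v)) \<le> real l * \<theta> ^ 3" .
  qed
  finally show ?thesis by (simp add: mult.commute)
next
  case False
  then have "potential n m \<theta> G = 0" by (simp add: potential_def)
  then have "mean (choices l n) (\<lambda>v. potential n m \<theta> (next_graph pick n i G v)) \<le> mean (choices l n) (\<lambda>v. 0)"
    using potential_next_le[OF M _ i m, of _ \<theta> G] l by (intro mean_mono) fastforce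
  then show ?thesis
    using \<open>potential n m \<theta> G = 0\<close> by (simp add: mean_def)
qed

lemma mean_potential_le:
  assumes M: "M_rule l pick" and l: "l \<ge> 4" and n: "n \<ge> 1" and m: "m \<ge> 1" and \<theta>: "\<theta> \<ge> 0"
    and d: "n div 2 + d \<le> T"
  shows "mean (samples l n T) (\<lambda>\<omega>. of_bool (real (large n (C_graph pick n (n div 2) \<omega>) (4 * m)) \<le> s) *
             potential n m \<theta> (C_graph pick n (n div 2 + d) \<omega>))
           \<le> (1 + real l * \<theta> ^ 3) ^ d * 2 powr (s / (8 * real m))"
  using d
proof (induction d)
  case 0
  have "mean (samples l n T) (\<lambda>\<omega>. of_bool (real (large n (C_graph pick n (n div 2) \<omega>) (4 * m)) \<le> s) *
             potential n m \<theta> (C_graph pick n (n div 2) \<omega>))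
          \<le> mean (samples l n T) (\<lambda>\<omega>. 2 powr (s / (8 * real m)))"
    by (intro mean_mono) (auto simp: potential_def divide_right_mono)
  then show ?case
    using samples_nonempty[OF n] by (simp add: mean_const)
next
  case (Suc d)
  let ?h = "n div 2" and ?i = "n div 2 + d"
  let ?c = "\<lambda>\<omega>. of_bool (real (large n (C_graph pick n ?h \<omega>) (4 * m)) \<le> s) :: real"
  have "mean (samples l n T) (\<lambda>\<omega>. ?c \<omega> * potential n m \<theta> (C_graph pick n (Suc ?i) \<omega>))
          = mean (samples l n T) (\<lambda>\<omega>. mean (choices l n) (\<lambda>v.
              ?c \<omega> * potential n m \<theta> (next_graph pick n ?i (C_graph pick n ?i \<omega>) v)))"
    by (rule mean_one_step[where h = ?h and
          H = "\<lambda>G0 G. of_bool (real (large n G0 (4 * m)) \<le> s) * potential n m \<theta> G"])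
       (use Suc.prems n in auto)
  also have "\<dots> \<le> mean (samples l n T) (\<lambda>\<omega>. (1 + real l * \<theta> ^ 3) *
              (?c \<omega> * potential n m \<theta> (C_graph pick n ?i \<omega>)))"
  proof (rule mean_mono)
    fix \<omega>
    show "mean (choices l n) (\<lambda>v. ?c \<omega> * potential n m \<theta> (next_graph pick n ?i (C_graph pick n ?i \<omega>) v))
            \<le> (1 + real l * \<theta> ^ 3) * (?c \<omega> * potential n m \<theta> (C_graph pick n ?i \<omega>))"
      unfolding mean_cmult using potential_step[OF M l n _ m, of ?i \<theta> "C_graph pick n ?i \<omega>"] by simp
  qed
  also have "\<dots> \<le> (1 + real l * \<theta> ^ 3) * ((1 + real l * \<theta> ^ 3) ^ d * 2 powr (s / (8 * real m)))"
    unfolding mean_cmult using Suc \<theta> by (intro mult_left_mono) auto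
  finally show ?case by (simp add: mult.assoc)
qed

text \<open>
  The scale \<open>4 m\<close> is controlled by the scale \<open>m\<close>: unless the smaller scale is overfull at the end,
  or the larger scale is overfull at the start, the exponential Markov inequality applies to the
  potential. Monotonicity in time makes it enough to look at the smaller scale at the end.
\<close>

lemma large_tail_bound:
  assumes M: "M_rule l pick" and l: "l \<ge> 4" and n: "n \<ge> 1" and m: "m \<ge> 1" and \<theta>: "\<theta> \<ge> 0"
    and T: "n div 2 \<le> T"
  shows "mean (samples l n T) (\<lambda>\<omega>. of_bool (real (large n (C_graph pick n T \<omega>) (4 * m)) > t))
           \<le> mean (samples l n T) (\<lambda>\<omega>. of_bool (real (large n (C_graph pick n T \<omega>) m) > \<theta> * real n))
           + mean (samples l n T) (\<lambda>\<omega>. of_bool (real (large n (C_graph pick n (n div 2) \<omega>) (4 * m)) > s))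
           + (1 + real l * \<theta> ^ 3) ^ (T - n div 2) * 2 powr ((s - t) / (8 * real m))"
proof -
  \<comment> \<open>The normalisation of Markov's inequality: \<open>c\<close> times the power in the potential is at least 1
      on the event to be bounded.\<close>
  define c where "c = 2 powr (- t / (8 * real m))"
  let ?start = "\<lambda>\<omega>. real (large n (C_graph pick n (n div 2) \<omega>) (4 * m))"
  have "mean (samples l n T) (\<lambda>\<omega>. of_bool (real (large n (C_graph pick n T \<omega>) (4 * m)) > t))
      \<le> mean (samples l n T) (\<lambda>\<omega>. of_bool (real (large n (C_graph pick n T \<omega>) m) > \<theta> * real n)
           + of_bool (?start \<omega> > s)
           + c * (of_bool (?start \<omega> \<le> s) * potential n m \<theta> (C_graph pick n T \<omega>)))"
  proof (rule mean_mono)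
    fix \<omega>
    let ?G = "C_graph pick n T \<omega>"
    have c: "c \<ge> 0" by (simp add: c_def)
    have "1 \<le> c * 2 powr (real (large n ?G (4 * m)) / (8 * real m))"
      if "real (large n ?G (4 * m)) > t"
      unfolding c_def powr_add[symmetric] using that m
      by (intro ge_one_powr_ge_zero) (auto simp: divide_right_mono)
    then show "of_bool (real (large n ?G (4 * m)) > t)
        \<le> of_bool (real (large n ?G m) > \<theta> * real n) + of_bool (?start \<omega> > s)
           + c * (of_bool (?start \<omega> \<le> s) * potential n m \<theta> ?G)"
      using c by (auto simp: potential_def)
  qed
  also have "\<dots> = mean (samples l n T) (\<lambda>\<omega>. of_bool (real (large n (C_graph pick n T \<omega>) m) > \<theta> * real n))
           + mean (samples l n T) (\<lambda>\<omega>. of_bool (?start \<omega> > s))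
           + c * mean (samples l n T) (\<lambda>\<omega>. of_bool (?start \<omega> \<le> s) * potential n m \<theta> (C_graph pick n T \<omega>))"
    unfolding mean_add mean_cmult ..
  also have "\<dots> \<le> mean (samples l n T) (\<lambda>\<omega>. of_bool (real (large n (C_graph pick n T \<omega>) m) > \<theta> * real n))
           + mean (samples l n T) (\<lambda>\<omega>. of_bool (?start \<omega> > s))
           + c * ((1 + real l * \<theta> ^ 3) ^ (T - n div 2) * 2 powr (s / (8 * real m)))"
    using mean_potential_le[OF M l n m \<theta>, of "T - n div 2" T s] T
    by (intro add_left_mono mult_left_mono) (auto simp: c_def)
  finally show ?thesis
    by (simp add: c_def diff_divide_distrib powr_diff powr_minus field_simps)
qed

text \<open>
  Induction over the scales. At criticality the scale \<open>4 ^ j\<close> holds at most \<open>8 n / 2 ^ j\<close> vertices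
  whp, and it may double. A step that adds to the scale \<open>4 ^ Suc j\<close> has probability at most
  \<open>p = l (16 / 2 ^ j)\<^sup>3\<close>, while the admissible growth divided by the largest possible gain per step is
  \<open>n / (2 * 8 ^ j)\<close>. Both are proportional to \<open>1 / 8 ^ j\<close>, which is why one \<open>\<delta>\<close> serves all
  scales; with \<open>l = 3\<close> the probability would only be of order \<open>1 / 4 ^ j\<close>.
\<close>

lemma supercritical_large_bound:
  fixes l :: nat
  assumes M: "M_rule l pick" and l: "l \<ge> 4"
  defines "\<delta> \<equiv> 1 / (2 ^ 14 * real l)"
  defines "T \<equiv> \<lambda>n. nat \<lfloor>real n / 2 + \<delta> * real n\<rfloor>"
  shows "(\<lambda>n. mean (samples l n (T n)) (\<lambda>\<omega>.
            of_bool (real (large n (C_graph pick n (T n) \<omega>) (4 ^ j)) > 16 / 2 ^ j * real n))) \<longlonglongrightarrow> 0"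
proof (induction j)
  case 0
  show ?case
  proof (rule mean_of_bool_tendsto_0_mono[where Q = "\<lambda>_ _. False"])
    show "\<forall>\<^sub>F n in sequentially. \<forall>\<omega>.
            real (large n (C_graph pick n (T n) \<omega>) (4 ^ 0)) > 16 / 2 ^ 0 * real n \<longrightarrow> False"
    proof (intro always_eventually allI)
      fix n \<omega>
      have "real (large n (C_graph pick n (T n) \<omega>) (4 ^ 0)) \<le> real n"
        using large_le[of n] by simp
      then show "real (large n (C_graph pick n (T n) \<omega>) (4 ^ 0)) > 16 / 2 ^ 0 * real n \<longrightarrow> False" by simp
    qed
  qed (simp add: mean_def)
next
  case (Suc j)
  define m :: nat where "m = 4 ^ j"
  define \<theta> :: real where "\<theta> = 16 / 2 ^ j"
  define p where "p = real l * \<theta> ^ 3"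
  define J :: real where "J = 1 / 8 ^ j"
  have \<delta>: "\<delta> > 0" using l by (simp add: \<delta>_def)
  have p0: "p \<ge> 0" by (simp add: p_def \<theta>_def)
  have J: "J > 0" by (simp add: J_def)
  \<comment> \<open>The value of \<open>\<delta>\<close> is chosen for this: \<open>1/4\<close> is less than \<open>ln 2 / 2\<close>.\<close>
  have p\<delta>: "p * \<delta> = J / 4"
    using l by (simp add: p_def \<theta>_def \<delta>_def J_def power_divide flip: power_mult_distrib power_mult)
       (simp add: power_mult mult.commute[of j])
  have T: "n div 2 \<le> T n" for n
  proof -
    have "real (n div 2) \<le> real n / 2" by linarith
    also have "\<dots> \<le> real n / 2 + \<delta> * real n" using \<delta> by simp
    finally have "int (n div 2) \<le> \<lfloor>real n / 2 + \<delta> * real n\<rfloor>"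
      by (simp add: le_floor_iff)
    then show ?thesis by (simp add: T_def)
  qed
  have steps: "real (T n - n div 2) \<le> \<delta> * real n + 1" for n
  proof -
    have "real (T n) \<le> real n / 2 + \<delta> * real n"
      using \<delta> by (simp add: T_def)
    moreover have "real n \<le> 2 * real (n div 2) + 1" by linarith
    ultimately show ?thesis using T[of n] by (simp add: of_nat_diff)
  qed
  define s where "s n = 8 / 2 ^ Suc j * real n" for n
  have key: "(1 + p) ^ (T n - n div 2) * 2 powr ((s n - 16 / 2 ^ Suc j * real n) / (8 * real m))
               \<le> exp p * exp (- (J / 12)) ^ n" for n
  proof -
    have "(1 + p) ^ (T n - n div 2) \<le> exp p ^ (T n - n div 2)"
      using p0 by (intro power_mono) auto
    also have "\<dots> = exp (real (T n - n div 2) * p)"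
      by (simp add: exp_of_nat_mult)
    also have "\<dots> \<le> exp ((\<delta> * real n + 1) * p)"
      using steps[of n] p0 by (simp add: mult_right_mono)
    finally have A: "(1 + p) ^ (T n - n div 2) \<le> exp ((\<delta> * real n + 1) * p)" .
    have e: "(s n - 16 / 2 ^ Suc j * real n) / (8 * real m) = - (J / 2 * real n)"
    proof -
      have "(8::real) ^ j = 2 ^ j * 4 ^ j" by (simp flip: power_mult_distrib)
      then show ?thesis by (simp add: s_def m_def J_def field_simps)
    qed
    have "2 powr (- (J / 2 * real n)) = exp (- (J / 2 * real n) * ln 2)"
      by (simp add: powr_def)
    also have "\<dots> \<le> exp (- (J / 2 * real n) * (2 / 3))"
      using ln2_ge_two_thirds J by (simp add: mult_left_mono)
    finally have B: "2 powr (- (J / 2 * real n)) \<le> exp (- (J / 2 * real n) * (2 / 3))" .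
    have "(1 + p) ^ (T n - n div 2) * 2 powr (- (J / 2 * real n))
            \<le> exp ((\<delta> * real n + 1) * p) * exp (- (J / 2 * real n) * (2 / 3))"
      using A B by (intro mult_mono) auto
    also have "\<dots> = exp (p + (p * \<delta> - J / 3) * real n)"
      by (simp add: algebra_simps flip: exp_add)
    also have "\<dots> = exp p * exp (- (J / 12)) ^ n"
      unfolding p\<delta> by (simp add: mult.commute flip: exp_of_nat_mult exp_add)
    finally show ?thesis unfolding e .
  qed
  have bound: "mean (samples l n (T n)) (\<lambda>\<omega>. of_bool (real (large n (C_graph pick n (T n) \<omega>) (4 * m)) > 16 / 2 ^ Suc j * real n))
      \<le> mean (samples l n (T n)) (\<lambda>\<omega>. of_bool (real (large n (C_graph pick n (T n) \<omega>) m) > \<theta> * real n))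
        + mean (samples l n (T n)) (\<lambda>\<omega>. of_bool (real (large n (C_graph pick n (n div 2) \<omega>) (4 * m)) > s n))
        + exp p * exp (- (J / 12)) ^ n" if "n \<ge> 1" for n
    using large_tail_bound[OF M l that, of m \<theta> "T n" "16 / 2 ^ Suc j * real n" "s n"] key[of n] T[of n]
    unfolding p_def[symmetric] by (simp add: m_def \<theta>_def)
  have lim: "(\<lambda>n. mean (samples l n (T n)) (\<lambda>\<omega>. of_bool (real (large n (C_graph pick n (T n) \<omega>) m) > \<theta> * real n))
        + mean (samples l n (T n)) (\<lambda>\<omega>. of_bool (real (large n (C_graph pick n (n div 2) \<omega>) (4 * m)) > s n))
        + exp p * exp (- (J / 12)) ^ n) \<longlonglongrightarrow> 0 + 0 + exp p * 0"
  proof (intro tendsto_add tendsto_mult tendsto_const)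
    show "(\<lambda>n. mean (samples l n (T n)) (\<lambda>\<omega>. of_bool (real (large n (C_graph pick n (T n) \<omega>) m) > \<theta> * real n))) \<longlonglongrightarrow> 0"
      using Suc by (simp add: m_def \<theta>_def)
    show "(\<lambda>n. mean (samples l n (T n)) (\<lambda>\<omega>. of_bool (real (large n (C_graph pick n (n div 2) \<omega>) (4 * m)) > s n))) \<longlonglongrightarrow> 0"
      using critical_large_bound[where T = T and j = "Suc j" and l = l and pick = pick] T l by (simp add: m_def s_def)
    show "(\<lambda>n. exp (- (J / 12)) ^ n) \<longlonglongrightarrow> 0"
      using J by (intro LIMSEQ_power_zero) simp
  qed
  have "(\<lambda>n. mean (samples l n (T n)) (\<lambda>\<omega>. of_bool (real (large n (C_graph pick n (T n) \<omega>) (4 * m)) > 16 / 2 ^ Suc j * real n))) \<longlonglongrightarrow> 0"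
  proof (rule tendsto_sandwich[OF _ _ tendsto_const lim[simplified]])
    show "\<forall>\<^sub>F n in sequentially. 0 \<le> mean (samples l n (T n)) (\<lambda>\<omega>. of_bool (real (large n (C_graph pick n (T n) \<omega>) (4 * m)) > 16 / 2 ^ Suc j * real n))"
      by (intro always_eventually allI mean_nonneg) simp
  qed (rule eventually_mono[OF eventually_ge_at_top[of 1] bound])
  then show ?case by (simp add: m_def)
qed

text \<open>
  All vertices of a largest component are counted.
\<close>

lemma L1_le_large:
  assumes "n \<ge> 1" "k \<le> L1 n G"
  shows "L1 n G \<le> large n G k"
proof -
  have "L1 n G \<in> comp_size n G ` {1..n}"
    unfolding L1_def using assms(1) by (intro Max_in) auto
  then obtain v where v: "v \<in> {1..n}" "L1 n G = comp_size n G v" by auto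
  have "component n G v \<subseteq> {u \<in> {1..n}. k \<le> comp_size n G u}"
  proof
    fix u assume u: "u \<in> component n G v"
    then have "comp_size n G u = comp_size n G v"
      by (simp only: comp_size_def component_eq)
    then show "u \<in> {u \<in> {1..n}. k \<le> comp_size n G u}"
      using u component_subset[of n G v] assms(2) v(2) by auto
  qed
  then show ?thesis
    unfolding v(2) large_def comp_size_def[of n G v] by (intro card_mono) auto
qed

theorem corollary20:
  fixes l :: nat
  assumes "l \<ge> 4"
  shows "\<exists>\<delta>::real. \<delta> > 0 \<and> (\<forall>pick. M_rule l pick \<longrightarrow>
           tendsto_infinity_in_prob (vertex_space l)
             (\<lambda>n \<omega>. S n (C_graph pick n (n div 2) \<omega>)) \<and>
           tendsto_in_prob (vertex_space l)
             (\<lambda>n \<omega>. real (L1 n (C_graph pick n (nat \<lfloor>real n / 2 + \<delta> * real n\<rfloor>) \<omega>)) / real n) 0)"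
proof (intro exI[of _ "1 / (2 ^ 14 * real l)"] conjI allI impI)
  let ?\<delta> = "1 / (2 ^ 14 * real l)"
  show "?\<delta> > 0" using assms by simp
  fix pick assume M: "M_rule l pick"
  show "tendsto_infinity_in_prob (vertex_space l) (\<lambda>n \<omega>. S n (C_graph pick n (n div 2) \<omega>))"
    unfolding tendsto_infinity_in_prob_def
    using tendsto_measure_vertex_space[where T = "\<lambda>n. n div 2", OF critical_S_unbounded order_refl] assms
    by simp
  let ?T = "\<lambda>n. nat \<lfloor>real n / 2 + ?\<delta> * real n\<rfloor>"
  show "tendsto_in_prob (vertex_space l) (\<lambda>n \<omega>. real (L1 n (C_graph pick n (?T n) \<omega>)) / real n) 0"
    unfolding tendsto_in_prob_def
  proof (intro allI impI)
    fix \<epsilon> :: real assume \<epsilon>: "\<epsilon> > 0"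
    \<comment> \<open>A scale on which the power law allows fewer than \<open>\<epsilon> n\<close> vertices.\<close>
    obtain j where j: "(1 / 2) ^ j < \<epsilon> / 16"
      using real_arch_pow_inv[of "\<epsilon> / 16" "1 / 2"] \<epsilon> by auto
    have "(\<lambda>n. mean (samples l n (?T n)) (\<lambda>\<omega>.
             of_bool (\<bar>real (L1 n (C_graph pick n (?T n) \<omega>)) / real n - 0\<bar> > \<epsilon>))) \<longlonglongrightarrow> 0"
    proof (rule mean_of_bool_tendsto_0_mono[OF supercritical_large_bound[OF M assms, of j]])
      show "\<forall>\<^sub>F n in sequentially. \<forall>\<omega>. \<bar>real (L1 n (C_graph pick n (?T n) \<omega>)) / real n - 0\<bar> > \<epsilon> \<longrightarrow>
              real (large n (C_graph pick n (?T n) \<omega>) (4 ^ j)) > 16 / 2 ^ j * real n"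
        using eventually_ge_at_top[of "max 1 (nat \<lceil>4 ^ j / \<epsilon>\<rceil>)"]
      proof eventually_elim
        case (elim n)
        then have n: "n \<ge> 1" and "4 ^ j / \<epsilon> \<le> real n" by (simp, linarith)
        then have k: "4 ^ j \<le> \<epsilon> * real n"
          using \<epsilon> by (simp add: field_simps)
        show ?case
        proof (intro allI impI)
          fix \<omega>
          let ?G = "C_graph pick n (?T n) \<omega>"
          assume "\<bar>real (L1 n ?G) / real n - 0\<bar> > \<epsilon>"
          then have L: "\<epsilon> * real n < real (L1 n ?G)"
            using n by (simp add: field_simps)
          with k have "real (4 ^ j) \<le> real (L1 n ?G)"
            unfolding of_nat_power of_nat_numeral by linarith
          then have "L1 n ?G \<le> large n ?G (4 ^ j)"
            using n by (intro L1_le_large) (simp_all only: of_nat_le_iff)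
          moreover have "16 / 2 ^ j * real n \<le> \<epsilon> * real n"
            using j by (intro mult_right_mono) (simp_all add: power_divide)
          ultimately show "16 / 2 ^ j * real n < real (large n ?G (4 ^ j))"
            using L by linarith
        qed
      qed
    qed
    then show "(\<lambda>n. measure (vertex_space l n) {\<omega> \<in> space (vertex_space l n).
                 \<bar>real (L1 n (C_graph pick n (?T n) \<omega>)) / real n - 0\<bar> > \<epsilon>}) \<longlonglongrightarrow> 0"
      by (rule tendsto_measure_vertex_space) simp
  qed
qed

end
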